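(* Let $K$ be a number field of degree $3$, let $\xi\mapsto\xi^{(i)}$ ($i=1,2,3$) be the three embeddings of $K$ into $\mathbb{C}$, and let $\Sigma\subseteq\{1,2,3\}$ with $|\Sigma|\ge 2$. (i) Suppose that either $\Sigma=\{1,2,3\}$, or $K$ is totally real and $|\Sigma|=2$, or $\Sigma=\{i,j\}$ where the embeddings $\xi\mapsto\xi^{(i)}$ and $\xi\mapsto\xi^{(j)}$ are complex conjugate. Then $\kappa(\Sigma)=2$. (ii) Suppose that $\Sigma=\{i,j\}$ where one of the embeddings $\xi\mapsto\xi^{(i)}$, $\xi\mapsto\xi^{(j)}$ is real and the other is complex. Then $\kappa(\Sigma)=\frac{2}{3}$.
   Context: For an algebraic number $\alpha$ of degree $r$ with conjugates $\alpha^{(1)},\dots,\alpha^{(r)}$, let $a_0$ be the positive integer such that $a_0\prod_{i=1}^r(X-\alpha^{(i)})$ has integer coefficients with greatest common divisor $1$; the Mahler measure is $M(\alpha)=a_0\prod_{i=1}^r\max(1,|\alpha^{(i)}|)$. For a number field $K$ of degree $r$ with embeddings $\xi\mapsto\xi^{(i)}$ ($i=1,\dots,r$) into $\mathbb{C}$, an embedding is real if it maps $K$ into $\mathbb{R}$ and complex otherwise; two embeddings $i,j$ are complex conjugate if $\xi^{(j)}=\overline{\xi^{(i)}}$ for all $\xi\in K$. For $\Sigma\subseteq\{1,\dots,r\}$ with $|\Sigma|\ge2$, $\kappa(\Sigma)$ is defined as the infimum of all real numbers $\kappa$ for which there exists a constant $C(K)>0$ such that $\prod_{\{i,j\}\subset\Sigma}|\alpha^{(i)}-\alpha^{(j)}|\ge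 C(K)\,M(\alpha)^{-\kappa}$ for every $\alpha$ with $\mathbb{Q}(\alpha)=K$, where the product is over all $2$-element subsets $\{i,j\}$ of $\Sigma$ and $\alpha^{(i)}$ denotes the image of $\alpha$ under the $i$-th embedding. *)

theory Defs
  imports
    Complex_Main
    "HOL-Library.Extended_Real"
    "HOL-Computational_Algebra.Computational_Algebra"
begin

text \<open>
  A number field is a type \<open>'k\<close> of class \<^class>\<open>field_char_0\<close> of finite dimension over the rationals.
\<close>

lemma vector_space_rat:
  "vector_space (\<lambda>(q::rat) (x::'k::field_char_0). of_rat q * x)"
  by unfold_locales (simp_all add: algebra_simps of_rat_add of_rat_mult)

text \<open>
  The value is \<open>0\<close> for an infinite extension, so degree \<open>r > 0\<close> includes finiteness.
\<close>

definition number_field_degree :: "'k::field_char_0 itself \<Rightarrow> nat" where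
  "number_field_degree _ =
     vector_space.dim (\<lambda>(q::rat) (x::'k). of_rat q * x) (UNIV :: 'k set)"

definition is_subfield :: "'k::field_char_0 set \<Rightarrow> bool" where
  "is_subfield F \<longleftrightarrow>
     0 \<in> F \<and> 1 \<in> F \<and>
     (\<forall>x\<in>F. \<forall>y\<in>F. x + y \<in> F) \<and> (\<forall>x\<in>F. - x \<in> F) \<and>
     (\<forall>x\<in>F. \<forall>y\<in>F. x * y \<in> F) \<and> (\<forall>x\<in>F. inverse x \<in> F)"

text \<open>
  In characteristic \<open>0\<close> every subfield contains the rationals, so the subfield generated by
  \<open>\<alpha>\<close> is \<open>\<rat>(\<alpha>)\<close>.
\<close>

definition rat_adjoin :: "'k::field_char_0 \<Rightarrow> 'k set" where
  "rat_adjoin \<alpha> = is_subfield hull {\<alpha>}"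

definition field_embedding :: "('k::field_char_0 \<Rightarrow> complex) \<Rightarrow> bool" where
  "field_embedding \<sigma> \<longleftrightarrow>
     \<sigma> 1 = 1 \<and> (\<forall>x y. \<sigma> (x + y) = \<sigma> x + \<sigma> y) \<and> (\<forall>x y. \<sigma> (x * y) = \<sigma> x * \<sigma> y)"

definition real_embedding :: "('k::field_char_0 \<Rightarrow> complex) \<Rightarrow> bool" where
  "real_embedding \<sigma> \<longleftrightarrow> field_embedding \<sigma> \<and> range \<sigma> \<subseteq> \<real>"

definition complex_embedding :: "('k::field_char_0 \<Rightarrow> complex) \<Rightarrow> bool" where
  "complex_embedding \<sigma> \<longleftrightarrow> field_embedding \<sigma> \<and> \<not> range \<sigma> \<subseteq> \<real>"

definition conjugate_embeddings ::
    "('k::field_char_0 \<Rightarrow> complex) \<Rightarrow> ('k \<Rightarrow> complex) \<Rightarrow> bool" where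
  "conjugate_embeddings \<sigma> \<tau> \<longleftrightarrow> (\<forall>\<xi>. \<tau> \<xi> = cnj (\<sigma> \<xi>))"

definition totally_real :: "'k::field_char_0 itself \<Rightarrow> bool" where
  "totally_real _ \<longleftrightarrow> (\<forall>\<sigma> :: 'k \<Rightarrow> complex. field_embedding \<sigma> \<longrightarrow> real_embedding \<sigma>)"

definition rat_min_poly :: "'k::field_char_0 \<Rightarrow> rat poly" where
  "rat_min_poly \<alpha> =
     (THE p. lead_coeff p = 1 \<and> irreducible p \<and> poly (map_poly of_rat p) \<alpha> = 0)"

text \<open>
  The minimal polynomial is separable, so an algebraic number of degree \<open>r\<close> has exactly \<open>r\<close>
  conjugates, and a product over this set is the product over \<open>\<alpha>\<^sup>(\<^sup>1\<^sup>), \<dots>, \<alpha>\<^sup>(\<^sup>r\<^sup>)\<close>.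
\<close>

definition alg_conjugates :: "'k::field_char_0 \<Rightarrow> complex set" where
  "alg_conjugates \<alpha> = {z. poly (map_poly of_rat (rat_min_poly \<alpha>)) z = 0}"

definition alg_leading_coeff :: "'k::field_char_0 \<Rightarrow> int" where
  "alg_leading_coeff \<alpha> =
     (THE a. a > 0 \<and>
        (\<exists>P :: int poly. content P = 1 \<and>
           map_poly of_int P = smult (of_int a) (\<Prod>z\<in>alg_conjugates \<alpha>. [:- z, 1:])))"

definition alg_mahler_measure :: "'k::field_char_0 \<Rightarrow> real" where
  "alg_mahler_measure \<alpha> =
     of_int (alg_leading_coeff \<alpha>) * (\<Prod>z\<in>alg_conjugates \<alpha>. max 1 (cmod z))"

text \<open>
  The two-element subsets \<open>{i, j}\<close> of \<open>\<Sigma>\<close> are enumerated by the pairs with \<open>i < j\<close>. The infimum is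
  taken in the extended reals, where it is \<open>\<infinity>\<close> for the empty set and \<open>-\<infinity>\<close> for a set that is
  not bounded below.
\<close>

definition root_separation_exponent ::
    "(nat \<Rightarrow> 'k::field_char_0 \<Rightarrow> complex) \<Rightarrow> nat set \<Rightarrow> ereal" where
  "root_separation_exponent emb \<Sigma> =
     Inf (ereal ` {\<kappa> :: real. \<exists>C :: real. C > 0 \<and>
       (\<forall>\<alpha> :: 'k. rat_adjoin \<alpha> = UNIV \<longrightarrow>
          (\<Prod>(i, j)\<in>{(i, j). i \<in> \<Sigma> \<and> j \<in> \<Sigma> \<and> i < j}. cmod (emb i \<alpha> - emb j \<alpha>))
            \<ge> C * alg_mahler_measure \<alpha> powr (- \<kappa>))})"

end

theory Submission
  imports
    "HOL-Analysis.Kronecker_Approximation_Theorem"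
    "HOL-Library.Landau_Symbols"
    "Berlekamp_Zassenhaus.Factor_Bound"
    Defs
begin

text \<open>
  Write \<open>r\<close> for the degree. The discriminant \<open>a\<^sub>0\<^sup>2\<^sup>r\<^sup>-\<^sup>2 \<Prod>(\<alpha>\<^sub>i - \<alpha>\<^sub>j)\<^sup>2\<close> of the primitive form of
  \<open>\<alpha>\<close> is a nonzero integer, so \<open>a\<^sub>0\<^sup>r\<^sup>-\<^sup>1 \<Prod>|\<alpha>\<^sub>i - \<alpha>\<^sub>j| \<ge> 1\<close>. The pairs outside \<open>\<Sigma>\<close> are discarded by
  means of \<open>|\<alpha>\<^sub>i - \<alpha>\<^sub>j| \<le> 2 max(1,|\<alpha>\<^sub>i|) max(1,|\<alpha>\<^sub>j|)\<close>; as each index lies in \<open>r - 1\<close> pairs, this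
  gives \<open>\<kappa>(\<Sigma>) \<le> r - 1\<close>. If \<open>r = 3\<close>, \<open>\<alpha>\<^sub>1\<close> is real and \<open>\<alpha>\<^sub>2, \<alpha>\<^sub>3\<close> are complex conjugate, then
  \<open>|\<alpha>\<^sub>1 - \<alpha>\<^sub>3| = |\<alpha>\<^sub>1 - \<alpha>\<^sub>2|\<close> and \<open>|\<alpha>\<^sub>2 - \<alpha>\<^sub>3| \<le> 2|\<alpha>\<^sub>1 - \<alpha>\<^sub>2|\<close>, which improves the exponent to
  \<open>2/3\<close>.

  For the converse, apply unimodular matrices to a fixed generator \<open>\<alpha>\<close>. The numbers \<open>-1/(\<alpha> + n)\<close>
  have measure of order \<open>n\<^sup>r\<close> and all differences of order \<open>n\<^sup>-\<^sup>2\<close>, so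
  \<open>\<kappa>(\<Sigma>) \<ge> |\<Sigma>|(|\<Sigma>| - 1)/r\<close>. If \<open>\<alpha>\<^sub>k\<close> is real, take \<open>\<beta> = (p\<alpha> + q)/(t\<alpha> + s)\<close> with \<open>-s/t\<close> a
  Dirichlet approximation of \<open>\<alpha>\<^sub>k\<close>: the differences not involving \<open>k\<close> are of order \<open>t\<^sup>-\<^sup>2\<close>, while the
  factor of \<open>\<alpha>\<^sub>k\<close> in the measure drops from order \<open>t\<close> to \<open>1/t\<close>. Hence
  \<open>\<kappa>(\<Sigma>) \<ge> |\<Sigma>|(|\<Sigma>| - 1)/(r - 2)\<close> if \<open>k \<notin> \<Sigma>\<close>.
\<close>

section \<open>Embeddings and subfields\<close>

abbreviation rpoly :: "rat poly \<Rightarrow> 'a \<Rightarrow> 'a::field_char_0" where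
  "rpoly p x \<equiv> poly (map_poly of_rat p) x"

context field_char_0_hom
begin

lemmas field_hom_simps = hom_add hom_mult hom_uminus hom_minus hom_inverse hom_of_nat hom_of_int

lemma hom_of_rat: "hom (of_rat q) = of_rat q"
  by (cases q) (simp add: of_rat_rat divide_inverse field_hom_simps)

lemma hom_rpoly: "hom (rpoly p x) = rpoly p (hom x)"
  by (induction p) (simp_all add: map_poly_pCons field_hom_simps hom_of_rat)

end

lemma field_embedding_iff_hom: "field_embedding \<sigma> \<longleftrightarrow> field_char_0_hom \<sigma>"
proof
  assume \<sigma>: "field_embedding \<sigma>"
  have zero: "\<sigma> 0 = 0"
    using \<sigma> unfolding field_embedding_def by (metis add_cancel_right_right)
  then have "\<sigma> (- x) = - \<sigma> x" for x
    using \<sigma> unfolding field_embedding_def by (metis add_eq_0_iff)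
  moreover have "\<sigma> x * \<sigma> (inverse x) = 1" if "x \<noteq> 0" for x
    using \<sigma> that unfolding field_embedding_def by (metis right_inverse)
  ultimately show "field_char_0_hom \<sigma>"
    using \<sigma> zero by unfold_locales (auto simp: field_embedding_def)
next
  assume "field_char_0_hom \<sigma>"
  then interpret field_char_0_hom \<sigma> .
  show "field_embedding \<sigma>"
    by (simp add: field_embedding_def field_hom_simps)
qed

lemma field_embedding_cnj: "field_embedding \<sigma> \<Longrightarrow> field_embedding (\<lambda>x. cnj (\<sigma> x))"
  by (simp add: field_embedding_def)

lemma is_subfield_equalizer:
  assumes "field_embedding \<sigma>" "field_embedding \<tau>"
  shows "is_subfield {x. \<sigma> x = \<tau> x}"
proof -
  interpret \<sigma>: field_char_0_hom \<sigma> using assms(1) by (simp add: field_embedding_iff_hom)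
  interpret \<tau>: field_char_0_hom \<tau> using assms(2) by (simp add: field_embedding_iff_hom)
  show ?thesis
    by (auto simp: is_subfield_def \<sigma>.field_hom_simps \<tau>.field_hom_simps)
qed

lemma rpoly_in_subfield:
  assumes F: "is_subfield F" and "x \<in> F"
  shows "rpoly p x \<in> F"
proof -
  have nat: "of_nat n \<in> F" for n
    by (induction n) (use F in \<open>auto simp: is_subfield_def\<close>)
  have int: "of_int a \<in> F" for a
    by (cases a rule: int_cases2) (use F nat in \<open>auto simp: is_subfield_def\<close>)
  have rat: "of_rat q \<in> F" for q
    by (cases q) (use F int in \<open>auto simp: is_subfield_def of_rat_rat divide_inverse\<close>)
  show ?thesis
    by (induction p) (use F rat \<open>x \<in> F\<close> in \<open>auto simp: is_subfield_def map_poly_pCons\<close>)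
qed

abbreviation generator :: "'k::field_char_0 \<Rightarrow> bool" where
  "generator \<alpha> \<equiv> rat_adjoin \<alpha> = UNIV"

lemma generatorI:
  assumes "\<And>x. \<exists>p. x = rpoly p \<alpha>"
  shows "generator \<alpha>"
proof -
  have "x \<in> F" if "is_subfield F" "{\<alpha>} \<subseteq> F" for x F
    using assms[of x] rpoly_in_subfield[OF that(1)] that(2) by auto
  then show ?thesis
    unfolding rat_adjoin_def hull_def by auto
qed

lemma generator_embedding_neq:
  assumes "generator \<alpha>" "field_embedding \<sigma>" "field_embedding \<tau>" "\<sigma> \<noteq> \<tau>"
  shows "\<sigma> \<alpha> \<noteq> \<tau> \<alpha>"
proof
  assume "\<sigma> \<alpha> = \<tau> \<alpha>"
  then have "rat_adjoin \<alpha> \<subseteq> {x. \<sigma> x = \<tau> x}"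
    unfolding rat_adjoin_def by (intro hull_minimal) (use assms is_subfield_equalizer in auto)
  with assms show False
    by auto
qed

lemma separating_element_exists:
  fixes P :: "(('k::field_char_0 \<Rightarrow> complex) \<times> ('k \<Rightarrow> complex)) set"
  assumes "finite P"
    and "\<And>\<sigma> \<tau>. (\<sigma>, \<tau>) \<in> P \<Longrightarrow> field_embedding \<sigma> \<and> field_embedding \<tau> \<and> \<sigma> \<noteq> \<tau>"
  shows "\<exists>\<alpha>. \<forall>(\<sigma>, \<tau>) \<in> P. \<sigma> \<alpha> \<noteq> \<tau> \<alpha>"
  using assms
proof (induction P rule: finite_induct)
  case (insert pair P)
  obtain \<sigma> \<tau> where pair: "pair = (\<sigma>, \<tau>)"
    by (cases pair)
  obtain x where x: "\<sigma> x \<noteq> \<tau> x"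
    using insert.prems pair by blast
  obtain \<alpha> where \<alpha>: "\<phi> \<alpha> \<noteq> \<psi> \<alpha>" if "(\<phi>, \<psi>) \<in> P" for \<phi> \<psi>
    using insert by blast
  define collision where
    "collision = (\<lambda>(\<phi>, \<psi>). {n. \<phi> (\<alpha> + of_nat n * x) = (\<psi> (\<alpha> + of_nat n * x) :: complex)})"
  have "finite (collision (\<phi>, \<psi>))" if "(\<phi>, \<psi>) \<in> insert pair P" for \<phi> \<psi>
  proof -
    interpret \<phi>: field_char_0_hom \<phi>
      using insert.prems that by (simp flip: field_embedding_iff_hom)
    interpret \<psi>: field_char_0_hom \<psi>
      using insert.prems that by (simp flip: field_embedding_iff_hom)
    define q where "q = [:\<phi> \<alpha> - \<psi> \<alpha>, \<phi> x - \<psi> x:]"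
    have "q \<noteq> 0"
      using that x \<alpha> by (auto simp: q_def pair)
    then have "finite (of_nat -` {z. poly q z = 0} :: nat set)"
      by (intro finite_vimageI poly_roots_finite semiring_char_0_class.inj_of_nat)
    also have "of_nat -` {z. poly q z = 0} = collision (\<phi>, \<psi>)"
      by (auto simp: q_def collision_def \<phi>.field_hom_simps \<psi>.field_hom_simps algebra_simps)
    finally show ?thesis .
  qed
  then have "finite (\<Union>(collision ` insert pair P))"
    using insert.hyps by (auto simp: pair)
  then obtain n where "n \<notin> \<Union>(collision ` insert pair P)"
    using ex_new_if_finite infinite_UNIV_nat by blast
  then show ?case
    by (intro exI[of _ "\<alpha> + of_nat n * x"]) (auto simp: collision_def)
qed auto

section \<open>Minimal and primitive polynomials\<close>

interpretation of_rat_poly_hom: map_poly_comm_ring_hom of_rat ..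

lemma rat_min_poly_eqI:
  assumes "lead_coeff p = 1" "irreducible p" "rpoly p \<alpha> = 0"
  shows "rat_min_poly \<alpha> = p"
  unfolding rat_min_poly_def
proof (rule the_equality)
  fix q assume q: "lead_coeff q = 1 \<and> irreducible q \<and> rpoly q \<alpha> = 0"
  have "gcd p q \<noteq> 1"
  proof
    assume "gcd p q = 1"
    then obtain u v where bezout: "u * p + v * q = 1"
      by (metis bezout_coefficients_fst_snd)
    have "rpoly (u * p + v * q) \<alpha> = 0"
      using assms(3) q by (simp add: of_rat_poly_hom.hom_add of_rat_poly_hom.hom_mult)
    then show False
      by (simp add: bezout)
  qed
  then have "p dvd q" "q dvd p"
    using assms(2) q irreducible_imp_prime_elem_gcd prime_elem_imp_coprime
    by (metis coprime_imp_gcd_eq_1 gcd.commute)+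
  with assms(1) q show "q = p"
    by (intro poly_dvd_antisym) auto
qed (use assms in auto)

lemma irreducible_if_min_degree_annihilator:
  fixes \<alpha> :: "'a::field_char_0"
  assumes "p \<noteq> 0" "rpoly p \<alpha> = 0"
    and min: "\<And>q. q \<noteq> 0 \<Longrightarrow> rpoly q \<alpha> = 0 \<Longrightarrow> degree p \<le> degree q"
  shows "irreducible p"
proof (rule irreducibleI)
  show "\<not> p dvd 1"
  proof
    assume "p dvd 1"
    then obtain c where "p = [:c:]"
      by (metis is_unit_polyE)
    with assms(1,2) show False
      by simp
  qed
  fix u v assume p: "p = u * v"
  then have nz: "u \<noteq> 0" "v \<noteq> 0" and deg: "degree p = degree u + degree v"
    using \<open>p \<noteq> 0\<close> by (auto simp: degree_mult_eq)
  have "rpoly u \<alpha> = 0 \<or> rpoly v \<alpha> = 0"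
    using assms(2) by (simp add: p of_rat_poly_hom.hom_mult)
  with min[of u] min[of v] nz deg have "degree u = 0 \<or> degree v = 0"
    by auto
  with nz show "u dvd 1 \<or> v dvd 1"
    by (auto simp: is_unit_iff_degree)
qed fact

lemma monic_rat_poly_primitive_multiple:
  assumes "lead_coeff p = 1"
  obtains a P where "a > 0" "Polynomial.content P = 1" "of_int_poly P = smult (rat_of_int a) p"
proof -
  obtain d P where dP: "rat_to_normalized_int_poly p = (d, P)"
    by (cases "rat_to_normalized_int_poly p")
  note P = rat_to_normalized_int_poly[OF dP]
  define a where "a = lead_coeff P"
  have "lead_coeff p = d * of_int a"
    using arg_cong[OF P(1), of "\<lambda>q. coeff q (degree P)"] P(4) by (simp add: a_def)
  with assms have da: "d * of_int a = 1"
    by simp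
  then have "a > 0"
    using zero_less_mult_pos[of d "of_int a"] P(2) by simp
  moreover have "of_int_poly P = smult (of_int a) p"
    using da by (simp add: P(1) mult.commute)
  ultimately show thesis
    using that P(3) assms by fastforce
qed

lemma primitive_multiple_dvd:
  fixes p :: "'a::{idom, ring_char_0} poly"
  assumes "Polynomial.content P = 1" "of_int_poly P = smult (of_int a) p"
    and "of_int_poly Q = smult (of_int b) p"
  shows "a dvd b"
proof -
  have "of_int_poly (smult b P) = (of_int_poly (smult a Q) :: 'a poly)"
    by (simp add: of_int_hom.map_poly_hom_smult assms(2,3) mult.commute)
  then have "Polynomial.content (smult b P) = Polynomial.content (smult a Q)"
    by (metis of_int_poly_hom.injectivity)
  then have "\<bar>b\<bar> = \<bar>a\<bar> * Polynomial.content Q"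
    using assms(1) by simp
  then show ?thesis
    by (metis abs_dvd_iff dvd_abs_iff dvd_triv_left)
qed

section \<open>Number fields and their generators\<close>

lemma (in vector_space) independent_card_eq_dim_spans:
  assumes "independent B" "card B = dim UNIV" "0 < dim UNIV"
  shows "span B = UNIV"
proof (rule ccontr)
  assume "span B \<noteq> UNIV"
  then obtain v where v: "v \<notin> span B"
    by auto
  obtain C where C: "independent C" "UNIV \<subseteq> span C" "card C = dim UNIV"
    using basis_exists[of UNIV] by metis
  have "finite C" "finite B"
    using assms(2,3) C(3) by (simp_all add: card_ge_0_finite)
  have "v \<notin> B"
    using v span_superset by blast
  have "independent (insert v B)" "insert v B \<subseteq> span C"
    using v assms(1) C(2) \<open>v \<notin> B\<close> by (auto simp: independent_insert)
  then have "card (insert v B) \<le> card C"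
    using independent_span_bound[OF \<open>finite C\<close>] by blast
  then show False
    using C(3) assms(2) \<open>finite B\<close> \<open>v \<notin> B\<close> by simp
qed

locale number_field =
  fixes emb :: "nat \<Rightarrow> 'k::field_char_0 \<Rightarrow> complex" and I :: "nat set"
  assumes bij_emb: "bij_betw emb I {\<sigma>. field_embedding \<sigma>}"
    and card_I: "card I = number_field_degree TYPE('k)"
    and degree_pos: "0 < number_field_degree TYPE('k)"
begin

lemma finite_I [simp]: "finite I"
  using card_I degree_pos by (simp add: card_ge_0_finite)

lemma card_I_pos: "0 < card I"
  using card_I degree_pos by simp

lemma field_embedding_emb: "i \<in> I \<Longrightarrow> field_embedding (emb i)"
  using bij_emb by (auto simp: bij_betw_def)

lemma hom_emb: "i \<in> I \<Longrightarrow> field_char_0_hom (emb i)"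
  using field_embedding_emb by (simp add: field_embedding_iff_hom)

lemma emb_eq_iff: "i \<in> I \<Longrightarrow> j \<in> I \<Longrightarrow> emb i = emb j \<longleftrightarrow> i = j"
  using bij_emb by (auto simp: bij_betw_def inj_on_def)

lemma field_embeddingE:
  assumes "field_embedding \<sigma>"
  obtains i where "i \<in> I" "\<sigma> = emb i"
  using assms bij_emb by (auto simp: bij_betw_def)

definition conj_poly :: "'k \<Rightarrow> complex poly" where
  "conj_poly \<alpha> = (\<Prod>i\<in>I. [:- emb i \<alpha>, 1:])"

lemma lead_coeff_conj_poly: "lead_coeff (conj_poly \<alpha>) = 1"
  by (simp add: conj_poly_def lead_coeff_prod)

lemma degree_conj_poly: "degree (conj_poly \<alpha>) = card I"
  by (simp add: conj_poly_def degree_prod_eq_sum_degree)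

lemma poly_conj_poly: "poly (conj_poly \<alpha>) z = (\<Prod>i\<in>I. z - emb i \<alpha>)"
  by (simp add: conj_poly_def poly_prod)

lemma poly_conj_poly_eq_0_iff: "poly (conj_poly \<alpha>) z = 0 \<longleftrightarrow> (\<exists>i\<in>I. z = emb i \<alpha>)"
  by (simp add: poly_conj_poly)

lemma conjugate_is_root:
  assumes "rpoly p \<alpha> = 0" "i \<in> I"
  shows "rpoly p (emb i \<alpha>) = 0"
proof -
  interpret field_char_0_hom "emb i"
    by (rule hom_emb) fact
  show ?thesis
    by (metis assms(1) hom_rpoly hom_zero)
qed

lemma annihilator_eq_0:
  assumes "inj_on (\<lambda>i. emb i \<alpha>) I" "rpoly p \<alpha> = 0" "degree p < card I"
  shows "p = 0"
proof -
  have "map_poly of_rat p = (0 :: complex poly)"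
  proof (rule poly_eqI_degree)
    show "card ((\<lambda>i. emb i \<alpha>) ` I) > degree (map_poly of_rat p :: complex poly)"
      "card ((\<lambda>i. emb i \<alpha>) ` I) > degree (0 :: complex poly)"
      using assms(1,3) card_I_pos by (simp_all add: card_image)
  qed (use conjugate_is_root[OF assms(2)] in auto)
  then show ?thesis
    by simp
qed

lemma inj_on_powers:
  assumes "inj_on (\<lambda>i. emb i \<alpha>) I"
  shows "inj_on (\<lambda>n. \<alpha> ^ n) {..<card I}"
proof (rule inj_onI)
  fix m n assume mn: "m \<in> {..<card I}" "n \<in> {..<card I}" "\<alpha> ^ m = \<alpha> ^ n"
  have "monom 1 m - monom 1 n = (0 :: rat poly)"
  proof (rule annihilator_eq_0[OF assms])
    show "rpoly (monom 1 m - monom 1 n) \<alpha> = 0"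
      using mn by (simp add: of_rat_poly_hom.hom_minus map_poly_monom poly_monom)
    show "degree (monom 1 m - monom 1 n :: rat poly) < card I"
      using mn by (intro degree_diff_less) (simp_all add: degree_monom_eq)
  qed
  then show "m = n"
    by (metis eq_iff_diff_eq_0 degree_monom_eq zero_neq_one)
qed

lemma eq_rpolyE:
  assumes inj: "inj_on (\<lambda>i. emb i \<alpha>) I"
  obtains p where "degree p < card I" "x = rpoly p \<alpha>"
proof -
  interpret Q: vector_space "\<lambda>(q::rat) (x::'k). of_rat q * x"
    by (rule vector_space_rat)
  define pol :: "('k \<Rightarrow> rat) \<Rightarrow> rat poly" where "pol u = (\<Sum>n<card I. monom (u (\<alpha> ^ n)) n)" for u
  define P where "P = (\<lambda>n. \<alpha> ^ n) ` {..<card I}"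
  have comb: "(\<Sum>v\<in>P. of_rat (u v) * v) = rpoly (pol u) \<alpha>" for u
    by (simp add: P_def pol_def sum.reindex[OF inj_on_powers[OF inj]] of_rat_poly_hom.hom_sum
        map_poly_monom poly_sum poly_monom)
  have deg: "degree (pol u) < card I" for u
    unfolding pol_def using card_I_pos degree_monom_le le_less_trans
    by (intro degree_sum_less) blast+
  have "Q.independent P"
  proof
    assume "Q.dependent P"
    then obtain u v where v: "v \<in> P" "u v \<noteq> 0" and sum: "(\<Sum>v\<in>P. of_rat (u v) * v) = 0"
      by (auto simp: Q.dependent_finite P_def)
    have "pol u = 0"
      using annihilator_eq_0[OF inj _ deg] sum comb by metis
    moreover obtain n where n: "n < card I" "v = \<alpha> ^ n"
      using v(1) by (auto simp: P_def)
    moreover have "coeff (pol u) n = u (\<alpha> ^ n)"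
      using n(1) by (simp add: pol_def coeff_sum)
    ultimately show False
      using v(2) by simp
  qed
  moreover have "card P = Q.dim UNIV"
    using card_image[OF inj_on_powers[OF inj]] card_I
    by (simp add: P_def number_field_degree_def)
  ultimately have "x \<in> Q.span P"
    using degree_pos by (subst Q.independent_card_eq_dim_spans) (auto simp: number_field_degree_def)
  then obtain u where "x = (\<Sum>v\<in>P. of_rat (u v) * v)"
    by (auto simp: Q.span_finite P_def)
  with deg comb that show thesis
    by metis
qed

lemma generator_iff: "generator \<alpha> \<longleftrightarrow> inj_on (\<lambda>i. emb i \<alpha>) I"
proof
  assume "generator \<alpha>"
  then show "inj_on (\<lambda>i. emb i \<alpha>) I"
    using generator_embedding_neq field_embedding_emb emb_eq_iff by (metis inj_onI)
next
  assume "inj_on (\<lambda>i. emb i \<alpha>) I"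
  then show "generator \<alpha>"
    using eq_rpolyE by (metis generatorI)
qed

lemma generator_exists: "\<exists>\<alpha> :: 'k. generator \<alpha>"
proof -
  define P where "P = {(\<sigma>, \<tau>). \<sigma> \<in> emb ` I \<and> \<tau> \<in> emb ` I \<and> \<sigma> \<noteq> \<tau>}"
  have "finite P"
    by (rule finite_subset[of _ "emb ` I \<times> emb ` I"]) (auto simp: P_def)
  then have "\<exists>\<alpha>. \<forall>(\<sigma>, \<tau>) \<in> P. \<sigma> \<alpha> \<noteq> \<tau> \<alpha>"
    by (rule separating_element_exists) (use field_embedding_emb in \<open>auto simp: P_def\<close>)
  then obtain \<alpha> where \<alpha>: "\<forall>(\<sigma>, \<tau>) \<in> P. \<sigma> \<alpha> \<noteq> \<tau> \<alpha>"
    by blast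
  have "inj_on (\<lambda>i. emb i \<alpha>) I"
  proof (rule inj_onI, rule ccontr)
    fix i j assume "i \<in> I" "j \<in> I" "emb i \<alpha> = emb j \<alpha>" "i \<noteq> j"
    then show False
      using \<alpha> emb_eq_iff by (auto simp: P_def)
  qed
  then show ?thesis
    by (auto simp: generator_iff)
qed

lemma monic_annihilatorE:
  assumes "inj_on (\<lambda>i. emb i \<alpha>) I"
  obtains p where "degree p = card I" "lead_coeff p = 1" "rpoly p \<alpha> = 0"
proof -
  obtain q where q: "degree q < card I" "\<alpha> ^ card I = rpoly q \<alpha>"
    by (rule eq_rpolyE[OF assms])
  define p where "p = monom 1 (card I) - q"
  have "coeff p (card I) = 1"
    using q(1) by (simp add: p_def coeff_eq_0)
  moreover have "degree p \<le> card I"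
    unfolding p_def using q(1) by (intro degree_diff_le) (auto intro: degree_monom_le)
  ultimately have "degree p = card I" "lead_coeff p = 1"
    using le_degree[of p "card I"] by auto
  moreover have "rpoly p \<alpha> = 0"
    using q(2) by (simp add: p_def of_rat_poly_hom.hom_minus map_poly_monom poly_monom)
  ultimately show thesis
    by (rule that)
qed

lemma rat_min_poly_generator:
  assumes "generator \<alpha>"
  shows "lead_coeff (rat_min_poly \<alpha>) = 1" "map_poly of_rat (rat_min_poly \<alpha>) = conj_poly \<alpha>"
proof -
  have inj: "inj_on (\<lambda>i. emb i \<alpha>) I"
    using assms by (simp add: generator_iff)
  obtain p where p: "degree p = card I" "lead_coeff p = 1" and root: "rpoly p \<alpha> = 0"
    by (rule monic_annihilatorE[OF inj])
  have "p \<noteq> 0"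
    using p(2) by auto
  then have "irreducible p"
    using root
    by (rule irreducible_if_min_degree_annihilator) (use annihilator_eq_0[OF inj] p(1) in force)
  then have min_poly: "rat_min_poly \<alpha> = p"
    using p(2) root by (intro rat_min_poly_eqI)
  show "lead_coeff (rat_min_poly \<alpha>) = 1"
    by (simp add: min_poly p(2))
  have "map_poly of_rat p = conj_poly \<alpha>"
  proof (rule poly_eqI_degree_lead_coeff[where A = "(\<lambda>i. emb i \<alpha>) ` I"])
    show "coeff (map_poly of_rat p) (card I) = coeff (conj_poly \<alpha>) (card I)"
      using p lead_coeff_conj_poly[of \<alpha>] by (simp add: degree_conj_poly)
  qed (use p inj conjugate_is_root[OF root] in
      \<open>auto simp: card_image degree_conj_poly poly_conj_poly_eq_0_iff\<close>)
  then show "map_poly of_rat (rat_min_poly \<alpha>) = conj_poly \<alpha>"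
    by (simp add: min_poly)
qed

end

section \<open>The Mahler measure of a generator\<close>

context number_field
begin

lemma alg_conjugates_generator: "generator \<alpha> \<Longrightarrow> alg_conjugates \<alpha> = (\<lambda>i. emb i \<alpha>) ` I"
  by (auto simp: alg_conjugates_def rat_min_poly_generator(2) poly_conj_poly_eq_0_iff)

lemma prod_alg_conjugates:
  "generator \<alpha> \<Longrightarrow> (\<Prod>z\<in>alg_conjugates \<alpha>. f z) = (\<Prod>i\<in>I. f (emb i \<alpha>))"
  by (simp add: alg_conjugates_generator prod.reindex generator_iff)

lemma alg_leading_coeff_primitive:
  assumes "generator \<alpha>"
  obtains P where "0 < alg_leading_coeff \<alpha>" "Polynomial.content P = 1"
    "of_int_poly P = smult (of_int (alg_leading_coeff \<alpha>)) (conj_poly \<alpha>)"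
proof -
  obtain a P where a: "a > 0" and content: "Polynomial.content P = 1"
    and P: "of_int_poly P = smult (of_int a) (rat_min_poly \<alpha>)"
    using monic_rat_poly_primitive_multiple rat_min_poly_generator(1)[OF assms] by metis
  have "of_int_poly P = (map_poly of_rat (of_int_poly P) :: complex poly)"
    by (simp add: poly_eq_iff coeff_map_poly)
  also have "\<dots> = smult (of_int a) (conj_poly \<alpha>)"
    by (simp add: P map_poly_smult of_rat_mult rat_min_poly_generator(2)[OF assms])
  finally have multiple: "of_int_poly P = smult (of_int a) (conj_poly \<alpha>)" .
  have "alg_leading_coeff \<alpha> = a"
    unfolding alg_leading_coeff_def prod_alg_conjugates[OF assms] conj_poly_def[symmetric]
  proof (rule the_equality)
    fix b :: int
    assume b: "0 < b \<and> (\<exists>Q. Polynomial.content Q = 1 \<and>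
      of_int_poly Q = smult (of_int b) (conj_poly \<alpha>))"
    then have "a dvd b" "b dvd a"
      using primitive_multiple_dvd content multiple by blast+
    with b a show "b = a"
      by (auto intro: zdvd_antisym_nonneg)
  qed (use a content multiple in blast)
  with a content multiple show thesis
    by (intro that) auto
qed

lemma alg_leading_coeff_ge_1: "generator \<alpha> \<Longrightarrow> 1 \<le> alg_leading_coeff \<alpha>" for \<alpha> :: 'k
  by (erule alg_leading_coeff_primitive) simp

lemma alg_leading_coeff_le:
  assumes "generator \<alpha>" "b \<noteq> 0" "of_int_poly Q = smult b (conj_poly \<alpha>)"
  shows "of_int (alg_leading_coeff \<alpha>) \<le> cmod b"
proof -
  have "lead_coeff (of_int_poly Q :: complex poly) = b"
    by (simp only: assms(3) lead_coeff_smult lead_coeff_conj_poly mult_1_right)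
  then have b: "b = of_int (lead_coeff Q)"
    by simp
  obtain P where "Polynomial.content P = 1"
    "of_int_poly P = smult (of_int (alg_leading_coeff \<alpha>)) (conj_poly \<alpha>)"
    using alg_leading_coeff_primitive[OF assms(1)] .
  then have "alg_leading_coeff \<alpha> dvd lead_coeff Q"
    using assms(3) unfolding b by (rule primitive_multiple_dvd)
  then have "alg_leading_coeff \<alpha> \<le> \<bar>lead_coeff Q\<bar>"
    using assms(2) b by (intro zdvd_imp_le) auto
  also have "real_of_int \<bar>lead_coeff Q\<bar> = cmod b"
    by (simp add: b)
  finally show ?thesis
    by simp
qed

lemma mahler_measure_generator:
  "generator \<alpha> \<Longrightarrow> alg_mahler_measure \<alpha> =
    of_int (alg_leading_coeff \<alpha>) * (\<Prod>i\<in>I. max 1 (cmod (emb i \<alpha>)))"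
  by (simp add: alg_mahler_measure_def prod_alg_conjugates)

lemma mahler_measure_ge_1:
  fixes \<alpha> :: 'k
  assumes "generator \<alpha>"
  shows "1 \<le> alg_mahler_measure \<alpha>"
  unfolding mahler_measure_generator[OF assms]
  using mult_mono[of 1 "real_of_int (alg_leading_coeff \<alpha>)" 1 "\<Prod>i\<in>I. max 1 (cmod (emb i \<alpha>))"]
    alg_leading_coeff_ge_1[OF assms] by (simp add: prod_ge_1)

end

section \<open>Unimodular substitutions\<close>

abbreviation linear_form :: "int \<Rightarrow> int \<Rightarrow> 'a \<Rightarrow> 'a::ring_1" where
  "linear_form a b x \<equiv> of_int a * x + of_int b"

definition moebius :: "int \<Rightarrow> int \<Rightarrow> int \<Rightarrow> int \<Rightarrow> 'a \<Rightarrow> 'a::field" where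
  "moebius p q r s x = linear_form p q x / linear_form r s x"

lemma (in field_char_0_hom) hom_moebius: "hom (moebius p q r s x) = moebius p q r s (hom x)"
  by (simp add: moebius_def divide_inverse field_hom_simps)

lemma denominator_times_moebius:
  assumes "linear_form r s x \<noteq> (0 :: 'a::field)"
  shows "linear_form r s x * moebius p q r s x = linear_form p q x"
  using assms by (simp add: moebius_def)

lemma moebius_diff:
  fixes x y :: "'a::field"
  assumes det: "p * s - q * r = 1"
    and nz: "linear_form r s x \<noteq> 0" "linear_form r s y \<noteq> 0"
  shows "moebius p q r s x - moebius p q r s y =
    (x - y) / (linear_form r s x * linear_form r s y)"
proof -
  have "linear_form p q x * linear_form r s y
      - linear_form p q y * linear_form r s x
      = of_int (p * s - q * r) * (x - y)"
    by (simp add: algebra_simps)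
  with nz show ?thesis
    by (simp add: moebius_def diff_frac_eq det)
qed

lemma homogenized_poly_eq_prod:
  fixes P :: "'a::field poly"
  assumes "finite I" and P: "P = smult a (\<Prod>i\<in>I. [:- z i, 1:])"
  shows "(\<Sum>m\<le>card I. coeff P m * x ^ m * y ^ (card I - m)) = a * (\<Prod>i\<in>I. x - z i * y)"
proof (cases "y = 0")
  case True
  have "lead_coeff (\<Prod>i\<in>I. [:- z i, 1:]) = 1"
    by (simp add: lead_coeff_prod)
  moreover have "degree (\<Prod>i\<in>I. [:- z i, 1:]) = card I"
    by (simp add: degree_prod_eq_sum_degree)
  ultimately have "coeff P (card I) = a"
    unfolding P coeff_smult by (metis mult_1_right)
  moreover have "(\<Sum>m\<le>card I. coeff P m * x ^ m * y ^ (card I - m)) =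
      (\<Sum>m\<in>{card I}. coeff P m * x ^ m * y ^ (card I - m))"
    by (rule sum.mono_neutral_right) (auto simp: True)
  ultimately show ?thesis
    by (simp add: True)
next
  case False
  have "degree P \<le> card I"
    by (simp add: P degree_prod_eq_sum_degree)
  then have "(\<Sum>m\<le>card I. coeff P m * x ^ m * y ^ (card I - m)) =
      y ^ card I * (\<Sum>m\<le>degree P. coeff P m * (x / y) ^ m)"
    unfolding sum_distrib_left using False
    by (intro sum.mono_neutral_cong_right) (auto simp: coeff_eq_0 power_diff field_simps)
  also have "\<dots> = y ^ card I * poly P (x / y)"
    by (simp add: poly_altdef)
  also have "\<dots> = a * (\<Prod>i\<in>I. y * (x / y - z i))"
    by (simp add: P poly_prod prod.distrib)
  also have "(\<Prod>i\<in>I. y * (x / y - z i)) = (\<Prod>i\<in>I. x - z i * y)"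
    using False by (simp add: right_diff_distrib mult.commute)
  finally show ?thesis .
qed

context number_field
begin

lemma emb_moebius: "i \<in> I \<Longrightarrow> emb i (moebius p q r s \<alpha>) = moebius p q r s (emb i \<alpha>)"
  by (rule field_char_0_hom.hom_moebius) (rule hom_emb)

lemma linear_form_nonzero:
  fixes r s :: int
  assumes "generator \<alpha>" "2 \<le> card I" "i \<in> I" "r \<noteq> 0 \<or> s \<noteq> 0"
  shows "linear_form r s (emb i \<alpha>) \<noteq> 0"
proof
  interpret \<phi>: field_char_0_hom "emb i"
    by (rule hom_emb) fact
  define p where "p = [:rat_of_int s, of_int r:]"
  assume "linear_form r s (emb i \<alpha>) = 0"
  then have "emb i (of_int r * \<alpha> + of_int s) = 0"
    by (simp add: \<phi>.field_hom_simps)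
  then have "rpoly p \<alpha> = 0"
    by (simp add: p_def of_rat_hom.map_poly_pCons_hom algebra_simps)
  moreover have "degree p < card I"
    using assms(2) by (simp add: p_def)
  ultimately have "p = 0"
    using assms(1) annihilator_eq_0 by (simp add: generator_iff)
  with assms(4) show False
    by (simp add: p_def)
qed

lemma moebius_denominator_nonzero:
  assumes "generator \<alpha>" "2 \<le> card I" "p * s - q * r = 1" "i \<in> I"
  shows "linear_form r s (emb i \<alpha>) \<noteq> 0"
  by (rule linear_form_nonzero) (use assms in auto)

lemma emb_moebius_diff:
  fixes p q r s :: int
  assumes \<alpha>: "generator \<alpha>" "2 \<le> card I" and det: "p * s - q * r = 1" and ij: "i \<in> I" "j \<in> I"
  shows "emb i (moebius p q r s \<alpha>) - emb j (moebius p q r s \<alpha>) =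
    (emb i \<alpha> - emb j \<alpha>) / (linear_form r s (emb i \<alpha>) * linear_form r s (emb j \<alpha>))"
  unfolding emb_moebius[OF ij(1)] emb_moebius[OF ij(2)]
  by (intro moebius_diff det moebius_denominator_nonzero[OF \<alpha> det] ij)

lemma generator_moebius:
  fixes \<alpha> :: 'k
  assumes \<alpha>: "generator \<alpha>" "2 \<le> card I" and det: "p * s - q * r = 1"
  shows "generator (moebius p q r s \<alpha>)"
proof -
  have "emb i \<alpha> - emb j \<alpha> \<noteq> 0" if "i \<in> I" "j \<in> I" "i \<noteq> j" for i j
    using \<alpha>(1) that by (auto simp: generator_iff dest: inj_onD)
  then have "emb i (moebius p q r s \<alpha>) \<noteq> emb j (moebius p q r s \<alpha>)"
    if "i \<in> I" "j \<in> I" "i \<noteq> j" for i j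
    using emb_moebius_diff[OF \<alpha> det that(1,2)] moebius_denominator_nonzero[OF \<alpha> det] that
    by (metis divide_eq_0_iff mult_eq_0_iff right_minus_eq)
  then show ?thesis
    by (auto simp: generator_iff intro: inj_onI)
qed

text \<open>
  Substituting a unimodular matrix into the binary form of \<open>\<alpha>\<close> yields an integral form whose root is
  \<open>(p\<alpha> + q)/(r\<alpha> + s)\<close>.
\<close>

lemma integral_multiple_conj_poly_moebius:
  fixes p q r s :: int
  assumes P: "of_int_poly P = smult a (conj_poly \<alpha>)"
    and nz: "\<And>i. i \<in> I \<Longrightarrow> linear_form r s (emb i \<alpha>) \<noteq> 0"
  obtains Q where "of_int_poly Q =
    smult (a * (\<Prod>i\<in>I. linear_form r s (emb i \<alpha>))) (conj_poly (moebius p q r s \<alpha>))"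
proof
  define Q where
    "Q = (\<Sum>m\<le>card I. smult (coeff P m) ([:- q, s:] ^ m * [:p, - r:] ^ (card I - m)))"
  show "of_int_poly Q =
    smult (a * (\<Prod>i\<in>I. linear_form r s (emb i \<alpha>))) (conj_poly (moebius p q r s \<alpha>))"
  proof (subst poly_eq_poly_eq_iff[symmetric], rule ext)
    fix z :: complex
    define u v where "u = of_int s * z - of_int q" and "v = of_int p - of_int r * z"
    have "poly (of_int_poly Q) z =
        (\<Sum>m\<le>card I. coeff (of_int_poly P) m * u ^ m * v ^ (card I - m))"
      by (simp add: Q_def u_def v_def of_int_poly_hom.hom_sum of_int_poly_hom.hom_mult
          of_int_poly_hom.hom_power of_int_hom.map_poly_hom_smult of_int_hom.map_poly_pCons_hom
          poly_sum coeff_map_poly algebra_simps)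
    also have "\<dots> = a * (\<Prod>i\<in>I. u - emb i \<alpha> * v)"
      using P unfolding conj_poly_def by (intro homogenized_poly_eq_prod) simp_all
    also have "(\<Prod>i\<in>I. u - emb i \<alpha> * v) =
        (\<Prod>i\<in>I. linear_form r s (emb i \<alpha>) * (z - emb i (moebius p q r s \<alpha>)))"
      by (intro prod.cong) (simp_all add: emb_moebius right_diff_distrib
          denominator_times_moebius nz, simp add: u_def v_def algebra_simps)
    finally show "poly (of_int_poly Q) z = poly (smult
        (a * (\<Prod>i\<in>I. linear_form r s (emb i \<alpha>))) (conj_poly (moebius p q r s \<alpha>))) z"
      by (simp add: prod.distrib poly_conj_poly mult.assoc)
  qed
qed

lemma alg_leading_coeff_moebius_le:
  assumes \<alpha>: "generator \<alpha>" "2 \<le> card I" and det: "p * s - q * r = 1"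
  shows "of_int (alg_leading_coeff (moebius p q r s \<alpha>)) \<le>
    of_int (alg_leading_coeff \<alpha>) * (\<Prod>i\<in>I. cmod (linear_form r s (emb i \<alpha>)))"
proof -
  let ?a = "alg_leading_coeff \<alpha>" and ?l = "\<lambda>i. linear_form r s (emb i \<alpha>)"
  have nz: "?l i \<noteq> 0" if "i \<in> I" for i
    by (rule moebius_denominator_nonzero[OF assms that])
  obtain P where a: "0 < ?a" and P: "of_int_poly P = smult (of_int ?a) (conj_poly \<alpha>)"
    using alg_leading_coeff_primitive[OF \<alpha>(1)] by metis
  obtain Q where Q: "of_int_poly Q =
      smult (of_int ?a * (\<Prod>i\<in>I. ?l i)) (conj_poly (moebius p q r s \<alpha>))"
    using integral_multiple_conj_poly_moebius[OF P] nz by metis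
  have "of_int ?a * (\<Prod>i\<in>I. ?l i) \<noteq> 0"
    using a nz by simp
  then have "of_int (alg_leading_coeff (moebius p q r s \<alpha>)) \<le> cmod (of_int ?a * (\<Prod>i\<in>I. ?l i))"
    using alg_leading_coeff_le[OF generator_moebius[OF assms] _ Q] by simp
  also have "\<dots> = of_int ?a * (\<Prod>i\<in>I. cmod (?l i))"
    using a by (simp add: norm_mult prod_norm)
  finally show ?thesis .
qed

lemma mahler_measure_moebius_le:
  fixes p q r s :: int
  assumes \<alpha>: "generator \<alpha>" "2 \<le> card I" and det: "p * s - q * r = 1"
  shows "alg_mahler_measure (moebius p q r s \<alpha>) \<le> of_int (alg_leading_coeff \<alpha>) *
    (\<Prod>i\<in>I. max (cmod (linear_form r s (emb i \<alpha>))) (cmod (linear_form p q (emb i \<alpha>))))"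
proof -
  let ?a = "of_int (alg_leading_coeff \<alpha>)" and ?\<beta> = "moebius p q r s \<alpha>"
  have "alg_mahler_measure ?\<beta> \<le> ?a * (\<Prod>i\<in>I. cmod (linear_form r s (emb i \<alpha>))) *
      (\<Prod>i\<in>I. max 1 (cmod (emb i ?\<beta>)))"
    unfolding mahler_measure_generator[OF generator_moebius[OF assms]]
    by (intro mult_right_mono alg_leading_coeff_moebius_le[OF assms] prod_nonneg) auto
  also have "\<dots> = ?a * (\<Prod>i\<in>I. cmod (linear_form r s (emb i \<alpha>)) * max 1 (cmod (emb i ?\<beta>)))"
    by (simp only: prod.distrib mult.assoc)
  also have "(\<Prod>i\<in>I. cmod (linear_form r s (emb i \<alpha>)) * max 1 (cmod (emb i ?\<beta>))) =
      (\<Prod>i\<in>I. max (cmod (linear_form r s (emb i \<alpha>))) (cmod (linear_form p q (emb i \<alpha>))))"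
  proof (rule prod.cong[OF refl])
    fix i assume i: "i \<in> I"
    have "linear_form r s (emb i \<alpha>) * emb i ?\<beta> = linear_form p q (emb i \<alpha>)"
      unfolding emb_moebius[OF i]
      by (rule denominator_times_moebius[OF moebius_denominator_nonzero[OF assms i]])
    then show "cmod (linear_form r s (emb i \<alpha>)) * max 1 (cmod (emb i ?\<beta>)) =
        max (cmod (linear_form r s (emb i \<alpha>))) (cmod (linear_form p q (emb i \<alpha>)))"
      by (simp only: max_mult_distrib_left norm_ge_zero if_True mult_1_right flip: norm_mult)
  qed
  finally show ?thesis .
qed

end

section \<open>Products over pairs of indices\<close>

definition increasing_pairs :: "'a::linorder set \<Rightarrow> ('a \<times> 'a) set" where
  "increasing_pairs S = {(i, j). i \<in> S \<and> j \<in> S \<and> i < j}"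

lemma increasing_pairs_subset: "increasing_pairs S \<subseteq> S \<times> S"
  by (auto simp: increasing_pairs_def)

lemma increasing_pairs_mono: "S \<subseteq> T \<Longrightarrow> increasing_pairs S \<subseteq> increasing_pairs T"
  by (auto simp: increasing_pairs_def)

lemma finite_increasing_pairs: "finite S \<Longrightarrow> finite (increasing_pairs S)"
  using finite_subset[OF increasing_pairs_subset] by blast

lemma increasing_pairs_empty: "increasing_pairs {} = {}"
  by (simp add: increasing_pairs_def)

lemma increasing_pairs_insert:
  assumes "k \<notin> S"
  shows "increasing_pairs (insert k S) =
    increasing_pairs S \<union> (\<lambda>i. if i < k then (i, k) else (k, i)) ` S" (is "_ = _ \<union> ?pair ` S")
proof (intro equalityI subsetI)
  fix x assume "x \<in> increasing_pairs (insert k S)"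
  then consider "x \<in> increasing_pairs S" | i where "i \<in> S" "i < k" "x = (i, k)"
    | i where "i \<in> S" "k < i" "x = (k, i)"
    by (auto simp: increasing_pairs_def)
  then show "x \<in> increasing_pairs S \<union> ?pair ` S"
    by cases (auto simp: image_iff)
next
  fix x assume "x \<in> increasing_pairs S \<union> ?pair ` S"
  with assms show "x \<in> increasing_pairs (insert k S)"
    by (auto simp: increasing_pairs_def not_less le_less split: if_splits)
qed

lemma prod_increasing_pairs_insert:
  fixes f :: "'a::linorder \<Rightarrow> 'a \<Rightarrow> 'b::comm_monoid_mult"
  assumes "finite S" "k \<notin> S" and commute: "\<And>i j. f i j = f j i"
  shows "(\<Prod>(i, j)\<in>increasing_pairs (insert k S). f i j) =
    (\<Prod>(i, j)\<in>increasing_pairs S. f i j) * (\<Prod>i\<in>S. f i k)"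
proof -
  define pair where "pair i = (if i < k then (i, k) else (k, i))" for i
  have "increasing_pairs S \<inter> pair ` S = {}"
    using \<open>k \<notin> S\<close> by (auto simp: increasing_pairs_def pair_def split: if_splits)
  moreover have "(\<Prod>(i, j)\<in>pair ` S. f i j) = (\<Prod>i\<in>S. f i k)"
  proof (subst prod.reindex)
    show "inj_on pair S"
      by (auto simp: inj_on_def pair_def split: if_splits)
    show "prod ((\<lambda>(i, j). f i j) \<circ> pair) S = (\<Prod>i\<in>S. f i k)"
      using commute by (intro prod.cong) (auto simp: pair_def)
  qed
  moreover have "increasing_pairs (insert k S) = increasing_pairs S \<union> pair ` S"
    unfolding pair_def by (rule increasing_pairs_insert) fact
  ultimately show ?thesis
    using assms(1) by (simp add: prod.union_disjoint finite_increasing_pairs)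
qed

lemma prod_increasing_pairs_mult:
  fixes g :: "'a::linorder \<Rightarrow> 'b::comm_monoid_mult"
  assumes "finite S"
  shows "(\<Prod>(i, j)\<in>increasing_pairs S. g i * g j) = (\<Prod>i\<in>S. g i ^ (card S - 1))"
  using assms
proof (induction S rule: finite_induct)
  case empty
  then show ?case
    by (simp add: increasing_pairs_empty)
next
  case (insert k S)
  have "(\<Prod>i\<in>S. g i ^ (card S - 1)) * (\<Prod>i\<in>S. g i * g k) = (\<Prod>i\<in>S. g i ^ card S) * g k ^ card S"
  proof (cases "S = {}")
    case False
    then have power: "g i ^ (card S - 1) * g i = g i ^ card S" for i
      using insert.hyps(1) by (metis card_gt_0_iff power_minus_mult)
    have "(\<Prod>i\<in>S. g i ^ (card S - 1)) * (\<Prod>i\<in>S. g i * g k) =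
        (\<Prod>i\<in>S. g i ^ (card S - 1) * g i) * g k ^ card S"
      by (simp only: prod.distrib prod_constant mult.assoc)
    then show ?thesis
      by (simp only: power)
  qed simp
  then show ?case
    using insert by (simp add: prod_increasing_pairs_insert mult.commute)
qed

section \<open>Root separation exponents\<close>

lemma norm_diff_le_max_mult:
  fixes u v :: "'a::real_normed_vector"
  shows "norm (u - v) \<le> 2 * (max 1 (norm u) * max 1 (norm v))"
proof -
  have "max 1 (norm u) * 1 \<le> max 1 (norm u) * max 1 (norm v)"
    "1 * max 1 (norm v) \<le> max 1 (norm u) * max 1 (norm v)"
    by (intro mult_mono; simp)+
  then show ?thesis
    using norm_triangle_ineq4[of u v] by linarith
qed

lemma powr_uminus_bigo_powr_uminus:
  fixes f g :: "'a \<Rightarrow> real"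
  assumes "f \<in> O[F](g)" "0 \<le> k" "eventually (\<lambda>x. 0 < f x) F" "eventually (\<lambda>x. 0 < g x) F"
  shows "(\<lambda>x. g x powr (- k)) \<in> O[F](\<lambda>x. f x powr (- k))"
  unfolding powr_minus
proof (rule landau_o.big.inverse)
  show "(\<lambda>x. f x powr k) \<in> O[F](\<lambda>x. g x powr k)"
    using assms by (intro bigo_powr_nonneg) (auto elim: eventually_mono)
  show "eventually (\<lambda>x. f x powr k \<noteq> 0) F"
    using assms(3) by eventually_elim simp
  show "eventually (\<lambda>x. g x powr k \<noteq> 0) F"
    using assms(4) by eventually_elim simp
qed

lemma exponent_le_of_powr_bound:
  fixes M d t :: "nat \<Rightarrow> real"
  assumes bound: "C > 0" "\<And>n. C * M n powr (- \<kappa>) \<le> d n"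
    and M: "\<And>n. 1 \<le> M n" "M \<in> O(\<lambda>n. t n ^ a)"
    and d: "d \<in> O(\<lambda>n. inverse (t n) ^ b)"
    and t: "filterlim t at_top sequentially"
    and "0 < a" "0 < b"
  shows "b / a \<le> \<kappa>"
proof -
  define k where "k = max 0 \<kappa>"
  have t_pos: "eventually (\<lambda>n. 0 < t n) sequentially"
    using t by (auto simp: filterlim_at_top_dense)
  have "0 < M n" for n
    using M(1)[of n] by linarith
  then have "(\<lambda>n. (t n ^ a) powr (- k)) \<in> O(\<lambda>n. M n powr (- k))"
    using M(2) t_pos
    by (intro powr_uminus_bigo_powr_uminus) (auto simp: k_def elim: eventually_mono)
  also have "(\<lambda>n. M n powr (- k)) \<in> O(d)"
  proof (intro bigoI[where c = "1 / C"] always_eventually allI)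
    fix n
    have "C * M n powr (- k) \<le> C * M n powr (- \<kappa>)"
      using M(1) \<open>C > 0\<close> by (intro mult_left_mono powr_mono) (auto simp: k_def)
    also note bound(2)
    finally show "norm (M n powr (- k)) \<le> 1 / C * norm (d n)"
      using \<open>C > 0\<close> by (simp add: field_simps)
  qed
  also note d
  finally have bigo: "(\<lambda>n. (t n ^ a) powr (- k)) \<in> O(\<lambda>n. inverse (t n) ^ b)" .
  have lhs: "eventually (\<lambda>n. (t n ^ a) powr (- k) = t n powr (- (real a * k))) sequentially"
    and rhs: "eventually (\<lambda>n. inverse (t n) ^ b = t n powr (- real b)) sequentially"
    using t_pos
    by (eventually_elim, simp add: powr_minus powr_powr power_inverse flip: powr_realpow)+
  have "(\<lambda>n. t n powr (- (real a * k))) \<in> O(\<lambda>n. t n powr (- real b))"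
    using bigo unfolding landau_o.big.in_cong[OF lhs] landau_o.big.cong[OF rhs] .
  then have "b / a \<le> k"
    using \<open>0 < a\<close> by (simp add: powr_bigo_iff[OF t] field_simps)
  moreover have "0 < b / a"
    using \<open>0 < a\<close> \<open>0 < b\<close> by simp
  ultimately show ?thesis
    by (simp add: k_def)
qed

context number_field
begin

definition separation :: "nat set \<Rightarrow> 'k \<Rightarrow> real" where
  "separation S \<alpha> = (\<Prod>(i, j)\<in>increasing_pairs S. cmod (emb i \<alpha> - emb j \<alpha>))"

lemma separation_insert:
  assumes "finite S" "k \<notin> S"
  shows "separation (insert k S) \<alpha> = separation S \<alpha> * (\<Prod>i\<in>S. cmod (emb i \<alpha> - emb k \<alpha>))"
  unfolding separation_def
  using assms by (rule prod_increasing_pairs_insert) (rule norm_minus_commute)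

lemma separation_empty [simp]: "separation {} \<alpha> = 1"
  by (simp add: separation_def increasing_pairs_empty)

lemma root_separation_exponent_le:
  assumes "C > 0" "\<And>\<alpha>. generator \<alpha> \<Longrightarrow> C * alg_mahler_measure \<alpha> powr (- \<kappa>) \<le> separation S \<alpha>"
  shows "root_separation_exponent emb S \<le> ereal \<kappa>"
  unfolding root_separation_exponent_def
  using assms by (intro Inf_lower) (auto simp: separation_def increasing_pairs_def)

lemma root_separation_exponent_ge:
  fixes \<beta> :: "nat \<Rightarrow> 'k" and t :: "nat \<Rightarrow> real"
  assumes \<beta>: "\<And>n. generator (\<beta> n)"
    and "(\<lambda>n. alg_mahler_measure (\<beta> n)) \<in> O(\<lambda>n. t n ^ a)"
    and "(\<lambda>n. separation S (\<beta> n)) \<in> O(\<lambda>n. inverse (t n) ^ b)"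
    and "filterlim t at_top sequentially" "0 < a" "0 < b"
  shows "ereal (b / a) \<le> root_separation_exponent emb S"
  unfolding root_separation_exponent_def
proof (rule Inf_greatest, clarify)
  fix \<kappa> C :: real
  assume "C > 0" and bound: "\<forall>\<alpha>. generator \<alpha> \<longrightarrow> C * alg_mahler_measure \<alpha> powr (- \<kappa>) \<le>
    (\<Prod>(i, j)\<in>{(i, j). i \<in> S \<and> j \<in> S \<and> i < j}. cmod (emb i \<alpha> - emb j \<alpha>))"
  have "b / a \<le> \<kappa>"
  proof (rule exponent_le_of_powr_bound[OF \<open>C > 0\<close>])
    show "C * alg_mahler_measure (\<beta> n) powr (- \<kappa>) \<le> separation S (\<beta> n)" for n
      using bound \<beta> by (simp add: separation_def increasing_pairs_def)
  qed (use assms mahler_measure_ge_1 in auto)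
  then show "ereal (b / a) \<le> ereal \<kappa>"
    by simp
qed

lemma separation_nonneg: "0 \<le> separation S \<alpha>"
  by (auto simp: separation_def intro: prod_nonneg)

lemma separation_le_separation_subset:
  assumes "S \<subseteq> I"
  shows "separation I \<alpha> \<le> 2 ^ card (increasing_pairs I) *
    (\<Prod>i\<in>I. max 1 (cmod (emb i \<alpha>))) ^ (card I - 1) * separation S \<alpha>"
proof -
  define m where "m i = max 1 (cmod (emb i \<alpha>))" for i
  let ?P = "increasing_pairs I" and ?Q = "increasing_pairs S"
  have m_ge_1: "1 \<le> 2 * (m i * m j)" for i j
    using mult_mono[of 1 "m i" 1 "m j"] unfolding m_def by linarith
  have "separation I \<alpha> = (\<Prod>(i, j)\<in>?P - ?Q. cmod (emb i \<alpha> - emb j \<alpha>)) * separation S \<alpha>"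
    unfolding separation_def using increasing_pairs_mono[OF assms]
    by (rule prod.subset_diff) (simp add: finite_increasing_pairs)
  also have "(\<Prod>(i, j)\<in>?P - ?Q. cmod (emb i \<alpha> - emb j \<alpha>)) \<le> (\<Prod>(i, j)\<in>?P - ?Q. 2 * (m i * m j))"
    unfolding m_def by (intro prod_mono) (auto simp: norm_diff_le_max_mult)
  also have "\<dots> \<le> (\<Prod>(i, j)\<in>?P. 2 * (m i * m j))"
    using m_ge_1
    by (intro prod_mono2) (auto simp: finite_increasing_pairs intro: order_trans[OF zero_le_one])
  also have "\<dots> = 2 ^ card ?P * (\<Prod>i\<in>I. m i) ^ (card I - 1)"
    using prod_increasing_pairs_mult[OF finite_I, of m]
    by (simp add: case_prod_unfold prod.distrib prod_power_distrib)
  finally show ?thesis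
    by (simp add: mult_right_mono separation_nonneg m_def)
qed

lemma separation_lower_bound:
  assumes \<alpha>: "generator \<alpha>" and "S \<subseteq> I"
    and disc: "1 \<le> real_of_int (alg_leading_coeff \<alpha>) ^ (card I - 1) * separation I \<alpha>"
  shows "inverse (2 ^ card (increasing_pairs I)) * alg_mahler_measure \<alpha> powr (- real (card I - 1))
    \<le> separation S \<alpha>"
proof -
  define c where "c = (2 :: real) ^ card (increasing_pairs I)"
  have "1 \<le> real_of_int (alg_leading_coeff \<alpha>) ^ (card I - 1) *
      (c * (\<Prod>i\<in>I. max 1 (cmod (emb i \<alpha>))) ^ (card I - 1) * separation S \<alpha>)"
    unfolding c_def
    by (intro order_trans[OF disc] mult_left_mono separation_le_separation_subset[OF \<open>S \<subseteq> I\<close>])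
      (use alg_leading_coeff_ge_1[OF \<alpha>] in simp)
  then have "1 \<le> c * alg_mahler_measure \<alpha> ^ (card I - 1) * separation S \<alpha>"
    by (simp add: mahler_measure_generator[OF \<alpha>] power_mult_distrib mult_ac)
  then show ?thesis
    using mahler_measure_ge_1[OF \<alpha>] by (simp add: c_def powr_minus powr_realpow field_simps)
qed

end

section \<open>Families of generators with close conjugates\<close>

context number_field
begin

lemma separation_moebius:
  assumes \<alpha>: "generator \<alpha>" "2 \<le> card I" and det: "p * s - q * r = 1" and "S \<subseteq> I"
  shows "separation S (moebius p q r s \<alpha>) =
    (\<Prod>(i, j)\<in>increasing_pairs S. cmod (emb i \<alpha> - emb j \<alpha>) *
      (inverse (cmod (linear_form r s (emb i \<alpha>))) * inverse (cmod (linear_form r s (emb j \<alpha>)))))"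
  unfolding separation_def
proof (rule prod.cong[OF refl], clarify)
  fix i j assume "(i, j) \<in> increasing_pairs S"
  then have "i \<in> I" "j \<in> I"
    using \<open>S \<subseteq> I\<close> by (auto simp: increasing_pairs_def)
  then show "cmod (emb i (moebius p q r s \<alpha>) - emb j (moebius p q r s \<alpha>)) =
    cmod (emb i \<alpha> - emb j \<alpha>) *
      (inverse (cmod (linear_form r s (emb i \<alpha>))) * inverse (cmod (linear_form r s (emb j \<alpha>))))"
    by (simp only: emb_moebius_diff[OF \<alpha> det] norm_divide norm_mult divide_inverse
        inverse_mult_distrib norm_inverse)
qed

lemma separation_moebius_bigo:
  fixes p q r s :: "nat \<Rightarrow> int" and t :: "nat \<Rightarrow> real"
  assumes \<alpha>: "generator \<alpha>" "2 \<le> card I" and det: "\<And>n. p n * s n - q n * r n = 1"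
    and "S \<subseteq> I" and t: "filterlim t at_top sequentially"
    and lower: "\<And>i. i \<in> S \<Longrightarrow> t \<in> O(\<lambda>n. cmod (linear_form (r n) (s n) (emb i \<alpha>)))"
  shows "(\<lambda>n. separation S (moebius (p n) (q n) (r n) (s n) \<alpha>))
    \<in> O(\<lambda>n. inverse (t n) ^ (card S * (card S - 1)))"
proof -
  define l where "l i n = inverse (cmod (linear_form (r n) (s n) (emb i \<alpha>)))" for i n
  have "finite S"
    using \<open>S \<subseteq> I\<close> by (rule finite_subset) simp
  have nz: "linear_form (r n) (s n) (emb i \<alpha>) \<noteq> 0" if "i \<in> S" for i n
    using moebius_denominator_nonzero[OF \<alpha> det] that \<open>S \<subseteq> I\<close> by blast
  have "eventually (\<lambda>n. 0 < t n) sequentially"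
    using t by (simp add: filterlim_at_top_dense)
  then have "eventually (\<lambda>n. t n \<noteq> 0) sequentially"
    by eventually_elim simp
  then have l: "l i \<in> O(\<lambda>n. inverse (t n))" if "i \<in> S" for i
    unfolding l_def using nz[OF that] by (intro landau_o.big.inverse lower that) auto
  have "(\<lambda>n. \<Prod>(i, j)\<in>increasing_pairs S. cmod (emb i \<alpha> - emb j \<alpha>) * (l i n * l j n))
      \<in> O(\<lambda>n. \<Prod>(i, j)\<in>increasing_pairs S. 1 * (inverse (t n) * inverse (t n)))"
    unfolding case_prod_unfold
    by (intro landau_o.big_prod landau_o.big.mult l) (auto simp: increasing_pairs_def)
  moreover have "(\<Prod>(i, j)\<in>increasing_pairs S. 1 * (inverse (t n) * inverse (t n))) =
      inverse (t n) ^ (card S * (card S - 1))" for n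
    using prod_increasing_pairs_mult[OF \<open>finite S\<close>, of "\<lambda>_. inverse (t n)"]
    by (simp add: mult.commute flip: power_mult)
  ultimately show ?thesis
    by (simp add: separation_moebius[OF \<alpha> det \<open>S \<subseteq> I\<close>] l_def)
qed

lemma mahler_measure_moebius_bigo:
  fixes p q r s :: "nat \<Rightarrow> int"
  assumes \<alpha>: "generator \<alpha>" "2 \<le> card I" and det: "\<And>n. p n * s n - q n * r n = 1"
    and g: "\<And>i. i \<in> I \<Longrightarrow> (\<lambda>n. cmod (linear_form (r n) (s n) (emb i \<alpha>))) \<in> O(g i)"
      "\<And>i. i \<in> I \<Longrightarrow> (\<lambda>n. cmod (linear_form (p n) (q n) (emb i \<alpha>))) \<in> O(g i)"
  shows "(\<lambda>n. alg_mahler_measure (moebius (p n) (q n) (r n) (s n) \<alpha>)) \<in> O(\<lambda>n. \<Prod>i\<in>I. g i n)"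
proof -
  define L where "L i n = cmod (linear_form (r n) (s n) (emb i \<alpha>))" for i n
  define N where "N i n = cmod (linear_form (p n) (q n) (emb i \<alpha>))" for i n
  have "(\<lambda>n. alg_mahler_measure (moebius (p n) (q n) (r n) (s n) \<alpha>)) \<in>
      O(\<lambda>n. of_int (alg_leading_coeff \<alpha>) * (\<Prod>i\<in>I. max (L i n) (N i n)))"
  proof (rule landau_o.big_mono, rule always_eventually, rule allI)
    fix n
    have "0 \<le> alg_mahler_measure (moebius (p n) (q n) (r n) (s n) \<alpha>)"
      using mahler_measure_ge_1[OF generator_moebius[OF \<alpha> det]]
      by (rule order_trans[OF zero_le_one])
    with mahler_measure_moebius_le[OF \<alpha> det]
    show "norm (alg_mahler_measure (moebius (p n) (q n) (r n) (s n) \<alpha>)) \<le>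
        norm (of_int (alg_leading_coeff \<alpha>) * (\<Prod>i\<in>I. max (L i n) (N i n)))"
      unfolding L_def N_def by (simp add: order_trans[OF _ abs_ge_self])
  qed
  also have "(\<lambda>n. of_int (alg_leading_coeff \<alpha>) * (\<Prod>i\<in>I. max (L i n) (N i n)))
      \<in> O(\<lambda>n. 1 * (\<Prod>i\<in>I. g i n))"
  proof (intro landau_o.big.mult landau_o.big_prod)
    fix i assume "i \<in> I"
    have "(\<lambda>n. max (L i n) (N i n)) \<in> O(\<lambda>n. L i n + N i n)"
      by (intro landau_o.big_mono always_eventually allI) (simp add: L_def N_def max_def)
    also have "(\<lambda>n. L i n + N i n) \<in> O(g i)"
      using g \<open>i \<in> I\<close> by (intro sum_in_bigo) (simp_all add: L_def N_def)
    finally show "(\<lambda>n. max (L i n) (N i n)) \<in> O(g i)" .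
  qed simp
  finally show ?thesis
    by simp
qed

end

lemma affine_bigtheta:
  fixes t :: "'a \<Rightarrow> real" and b :: "'a \<Rightarrow> complex"
  assumes "filterlim t at_top F" "b \<in> O[F](\<lambda>_. 1)" "c \<noteq> 0"
  shows "(\<lambda>n. cmod (of_real (t n) * c + b n)) \<in> \<Theta>[F](t)"
proof -
  have "filterlim (\<lambda>n. complex_of_real (t n)) at_infinity F"
    using filterlim_of_real_at_infinity assms(1) by (rule filterlim_compose)
  then have "(\<lambda>_. 1) \<in> o[F](\<lambda>n. complex_of_real (t n) * c)"
    using assms(3) by (simp add: smallomega_iff_smallo flip: smallomega_1_conv_filterlim)
  with assms(2) have "b \<in> o[F](\<lambda>n. of_real (t n) * c)"
    by (rule landau_o.big_small_trans)
  then have "\<Theta>[F](\<lambda>n. of_real (t n) * c + b n) = \<Theta>[F](\<lambda>n. of_real (t n) * c)"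
    by (rule landau_theta.plus_absorb2)
  then have "(\<lambda>n. of_real (t n) * c + b n) \<in> \<Theta>[F](\<lambda>n. of_real (t n) * c)"
    by (metis bigtheta_refl)
  then have "(\<lambda>n. of_real (t n) * c + b n) \<in> \<Theta>[F](\<lambda>n. of_real (t n))"
    using assms(3) by simp
  then have "(\<lambda>n. norm (of_real (t n) * c + b n)) \<in> \<Theta>[F](\<lambda>n. norm (of_real (t n) :: complex))"
    by (rule landau_theta.norm_iff[THEN iffD2])
  then show ?thesis
    by simp
qed

lemma one_bigo_at_top:
  fixes t :: "'a \<Rightarrow> real"
  assumes "filterlim t at_top F"
  shows "(\<lambda>_. 1) \<in> O[F](t)"
proof -
  have "eventually (\<lambda>n. 1 \<le> t n) F"
    using assms by (simp only: filterlim_at_top)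
  then show ?thesis
    by (intro landau_o.big_mono) (auto elim: eventually_mono)
qed

lemma unimodular_completion:
  fixes r s :: int
  assumes "gcd r s = 1" "0 < r"
  obtains p q where "p * s - q * r = 1" "0 \<le> p" "p < r"
proof -
  obtain u v where uv: "u * r + v * s = 1"
    using bezout_int[of r s] assms(1) by auto
  define p d where "p = v mod r" and "d = v div r"
  have "v = r * d + p"
    by (simp add: p_def d_def)
  then have "p * s - (- u - d * s) * r = u * r + v * s"
    by (simp add: algebra_simps)
  with uv have "p * s - (- u - d * s) * r = 1"
    by simp
  with assms(2) that show thesis
    by (simp add: p_def)
qed

lemma dirichlet_unimodular_matrix:
  fixes \<theta> :: real and K :: int
  assumes "\<theta> \<notin> \<rat>"
  obtains p q r s :: int where "p * s - q * r = 1" "K < r" "0 < r" "\<bar>p\<bar> \<le> r"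
    "\<bar>r * \<theta> + s\<bar> \<le> 1 / r" "\<bar>p * \<theta> + q\<bar> \<le> 2 / r"
proof -
  have "infinite (approx_set \<theta>)"
    using assms rational_iff_finite_approx_set by blast
  then obtain h r where hr: "(h, r) \<in> approx_set \<theta>" "max 0 K < r"
    using infinite_approx_set by blast
  then have r: "0 < r" and approx: "\<bar>\<theta> - h / r\<bar> < 1 / r\<^sup>2" and "gcd r (- h) = 1"
    by (auto simp: approx_set_def gcd.commute)
  obtain p q where det: "p * (- h) - q * r = 1" and p: "0 \<le> p" "p < r"
    by (rule unimodular_completion[OF \<open>gcd r (- h) = 1\<close> r])
  have "\<bar>r * \<theta> + (- h)\<bar> = r * \<bar>\<theta> - h / r\<bar>"
    using r by (simp add: abs_mult_pos' right_diff_distrib)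
  also have "\<dots> \<le> r * (1 / r\<^sup>2)"
    using approx r by (intro mult_left_mono) auto
  finally have s: "\<bar>r * \<theta> + (- h)\<bar> \<le> 1 / r"
    using r by (simp add: power2_eq_square)
  have "r * (p * \<theta> + q) = p * (r * \<theta> + (- h)) - real_of_int (p * (- h) - q * r)"
    by (simp add: algebra_simps)
  then have "r * \<bar>p * \<theta> + q\<bar> = \<bar>p * (r * \<theta> + (- h)) - 1\<bar>"
    using r by (simp only: det abs_mult_pos' of_int_1)
  also have "\<dots> \<le> p * \<bar>r * \<theta> + (- h)\<bar> + 1"
    using abs_triangle_ineq4[of "p * (r * \<theta> + (- h))" 1] p(1) by (simp add: abs_mult)
  also have "\<dots> \<le> r * (1 / r) + 1"
    using s p by (intro add_right_mono mult_mono) auto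
  finally have "\<bar>p * \<theta> + q\<bar> \<le> 2 / r"
    using r by (simp add: field_simps)
  with that[of p "- h" q r] det hr(2) r p s show thesis
    by simp
qed

lemma dirichlet_unimodular_sequence:
  fixes \<theta> :: real
  assumes "\<theta> \<notin> \<rat>"
  obtains p q r s :: "nat \<Rightarrow> int" where "\<And>n. p n * s n - q n * r n = 1"
    and "filterlim (\<lambda>n. real_of_int (r n)) at_top sequentially"
    and "(\<lambda>n. real_of_int (p n)) \<in> O(\<lambda>n. real_of_int (r n))"
    and "(\<lambda>n. cmod (linear_form (r n) (s n) (of_real \<theta>))) \<in> O(\<lambda>n. inverse (real_of_int (r n)))"
    and "(\<lambda>n. cmod (linear_form (p n) (q n) (of_real \<theta>))) \<in> O(\<lambda>n. inverse (real_of_int (r n)))"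
proof -
  have "\<exists>p q r s :: int. p * s - q * r = 1 \<and> int n < r \<and> \<bar>p\<bar> \<le> r \<and>
      \<bar>r * \<theta> + s\<bar> \<le> 1 / r \<and> \<bar>p * \<theta> + q\<bar> \<le> 2 / r" for n
    by (rule dirichlet_unimodular_matrix[OF assms, of "int n"]) blast
  then obtain p q r s :: "nat \<Rightarrow> int" where det: "\<And>n. p n * s n - q n * r n = 1"
    and r: "\<And>n. int n < r n" and p: "\<And>n. \<bar>p n\<bar> \<le> r n"
    and approx: "\<And>n. \<bar>r n * \<theta> + s n\<bar> \<le> 1 / r n" "\<And>n. \<bar>p n * \<theta> + q n\<bar> \<le> 2 / r n"
    by metis
  have cmod_real: "cmod (linear_form a b (of_real \<theta>)) = \<bar>a * \<theta> + b\<bar>" for a b :: int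
    using norm_of_real[of "a * \<theta> + b", where 'a = complex] by simp
  have "real n \<le> real_of_int (r n)" for n
    using r[of n] by linarith
  then have lim: "filterlim (\<lambda>n. real_of_int (r n)) at_top sequentially"
    by (intro filterlim_at_top_mono[OF filterlim_real_sequentially] always_eventually) simp
  have p_bigo: "(\<lambda>n. real_of_int (p n)) \<in> O(\<lambda>n. real_of_int (r n))"
  proof (intro landau_o.big_mono always_eventually allI)
    show "norm (real_of_int (p n)) \<le> norm (real_of_int (r n))" for n
      using p[of n] by (simp flip: of_int_abs)
  qed
  have bigo_inverse: "(\<lambda>n. \<bar>f n\<bar>) \<in> O(\<lambda>n. inverse (real_of_int (r n)))"
    if "\<And>n. \<bar>f n\<bar> \<le> c / r n" for f c
  proof (intro bigoI[where c = c] always_eventually allI)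
    show "norm \<bar>f n\<bar> \<le> c * norm (inverse (real_of_int (r n)))" for n
      using that[of n] r[of n] by (simp add: divide_inverse)
  qed
  show thesis
    by (rule that[OF det lim p_bigo])
      (simp_all only: cmod_real bigo_inverse[OF approx(1)] bigo_inverse[OF approx(2)])
qed

lemma linear_form_bigtheta:
  fixes r s :: "'a \<Rightarrow> int" and \<theta> z :: complex
  assumes "filterlim (\<lambda>n. real_of_int (r n)) at_top F"
    and "(\<lambda>n. cmod (linear_form (r n) (s n) \<theta>)) \<in> O[F](\<lambda>_. 1)" and "z \<noteq> \<theta>"
  shows "(\<lambda>n. cmod (linear_form (r n) (s n) z)) \<in> \<Theta>[F](\<lambda>n. real_of_int (r n))"
proof -
  have "linear_form (r n) (s n) z =
      of_real (real_of_int (r n)) * (z - \<theta>) + linear_form (r n) (s n) \<theta>" for n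
    by (simp add: algebra_simps)
  moreover have "(\<lambda>n. linear_form (r n) (s n) \<theta>) \<in> O[F](\<lambda>_. 1)"
    using assms(2) by (subst landau_o.big.norm_iff[symmetric]) simp
  ultimately show ?thesis
    using assms(1,3) by (simp only: affine_bigtheta right_minus_eq not_False_eq_True)
qed

lemma linear_form_bigo:
  fixes p q :: "'a \<Rightarrow> int" and \<theta> z :: complex
  assumes "(\<lambda>n. real_of_int (p n)) \<in> O[F](g)"
    and "(\<lambda>n. cmod (linear_form (p n) (q n) \<theta>)) \<in> O[F](g)"
  shows "(\<lambda>n. cmod (linear_form (p n) (q n) z)) \<in> O[F](g)"
proof -
  have "linear_form (p n) (q n) z = of_int (p n) * (z - \<theta>) + linear_form (p n) (q n) \<theta>" for n
    by (simp add: algebra_simps)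
  then have "cmod (linear_form (p n) (q n) z) \<le>
      \<bar>real_of_int (p n)\<bar> * cmod (z - \<theta>) + cmod (linear_form (p n) (q n) \<theta>)" for n
    by (metis norm_mult norm_of_int norm_triangle_ineq)
  then have "(\<lambda>n. cmod (linear_form (p n) (q n) z)) \<in> O[F](\<lambda>n.
      \<bar>real_of_int (p n)\<bar> * cmod (z - \<theta>) + cmod (linear_form (p n) (q n) \<theta>))"
    by (intro landau_o.big_mono always_eventually allI) simp
  also have "(\<lambda>n. \<bar>real_of_int (p n)\<bar> * cmod (z - \<theta>) +
      cmod (linear_form (p n) (q n) \<theta>)) \<in> O[F](g)"
  proof (rule sum_in_bigo)
    have "(\<lambda>n. \<bar>real_of_int (p n)\<bar>) \<in> O[F](g)"
      using assms(1) by simp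
    then show "(\<lambda>n. \<bar>real_of_int (p n)\<bar> * cmod (z - \<theta>)) \<in> O[F](g)"
      by (cases "z = \<theta>") simp_all
  qed fact
  finally show ?thesis .
qed

context number_field
begin

lemma root_separation_exponent_ge_card:
  assumes S: "S \<subseteq> I" "2 \<le> card S"
  shows "ereal (real (card S * (card S - 1)) / real (card I)) \<le> root_separation_exponent emb S"
proof -
  have I: "2 \<le> card I"
    using S card_mono[OF finite_I] by (meson order_trans)
  obtain \<alpha> :: 'k where \<alpha>: "generator \<alpha>"
    using generator_exists by blast
  have det: "0 * int n - (- 1) * 1 = 1" for n
    by simp
  have "(\<lambda>n. cmod (of_real (real n) * 1 + emb i \<alpha>)) \<in> \<Theta>(real)" for i
    by (rule affine_bigtheta[OF filterlim_real_sequentially]) simp_all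
  then have denominator: "(\<lambda>n. cmod (linear_form 1 (int n) (emb i \<alpha>))) \<in> \<Theta>(real)" for i
    by (simp add: add.commute)
  have numerator: "(\<lambda>n. cmod (linear_form 0 (- 1) (emb i \<alpha>))) \<in> O(real)" for i
    using one_bigo_at_top[OF filterlim_real_sequentially] by simp
  show ?thesis
  proof (rule root_separation_exponent_ge[OF generator_moebius[OF \<alpha> I det]])
    have "(\<lambda>n. alg_mahler_measure (moebius 0 (- 1) 1 (int n) \<alpha>)) \<in> O(\<lambda>n. \<Prod>i\<in>I. real n)"
      using denominator numerator by (intro mahler_measure_moebius_bigo[OF \<alpha> I det]) auto
    then show "(\<lambda>n. alg_mahler_measure (moebius 0 (- 1) 1 (int n) \<alpha>)) \<in> O(\<lambda>n. real n ^ card I)"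
      by simp
    show "(\<lambda>n. separation S (moebius 0 (- 1) 1 (int n) \<alpha>))
        \<in> O(\<lambda>n. inverse (real n) ^ (card S * (card S - 1)))"
      using denominator
      by (intro separation_moebius_bigo[OF \<alpha> I det S(1) filterlim_real_sequentially])
        (auto simp: bigtheta_sym)
  qed (use I S(2) filterlim_real_sequentially in auto)
qed

lemma real_conjugate_irrational:
  assumes "generator \<alpha>" "2 \<le> card I" "i \<in> I" "emb i \<alpha> = of_real \<theta>"
  shows "\<theta> \<notin> \<rat>"
proof
  assume "\<theta> \<in> \<rat>"
  then obtain u v :: int where "v > 0" "\<theta> = of_int u / of_int v"
    by (meson Rats_cases')
  then show False
    using linear_form_nonzero[OF assms(1-3), of v "- u"] assms(4) by simp
qed

lemma real_conjugate_sequenceE: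
  assumes \<alpha>: "generator \<alpha>" "2 \<le> card I" and k: "k \<in> I" "real_embedding (emb k)"
  obtains p q r s :: "nat \<Rightarrow> int" and t :: "nat \<Rightarrow> real"
    where "\<And>n. p n * s n - q n * r n = 1" and "filterlim t at_top sequentially"
    and "(\<lambda>n. cmod (linear_form (r n) (s n) (emb k \<alpha>))) \<in> O(\<lambda>n. inverse (t n))"
    and "(\<lambda>n. cmod (linear_form (p n) (q n) (emb k \<alpha>))) \<in> O(\<lambda>n. inverse (t n))"
    and "\<And>i. i \<in> I - {k} \<Longrightarrow> (\<lambda>n. cmod (linear_form (r n) (s n) (emb i \<alpha>))) \<in> \<Theta>(t)"
    and "\<And>i. i \<in> I - {k} \<Longrightarrow> (\<lambda>n. cmod (linear_form (p n) (q n) (emb i \<alpha>))) \<in> O(t)"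
proof -
  obtain \<theta> where \<theta>: "emb k \<alpha> = of_real \<theta>"
    using k(2) by (auto simp: real_embedding_def elim: Reals_cases)
  obtain p q r s :: "nat \<Rightarrow> int" where det: "\<And>n. p n * s n - q n * r n = 1"
    and lim: "filterlim (\<lambda>n. real_of_int (r n)) at_top sequentially"
    and p: "(\<lambda>n. real_of_int (p n)) \<in> O(\<lambda>n. real_of_int (r n))"
    and small: "(\<lambda>n. cmod (linear_form (r n) (s n) (emb k \<alpha>))) \<in> O(\<lambda>n. inverse (real_of_int (r n)))"
      "(\<lambda>n. cmod (linear_form (p n) (q n) (emb k \<alpha>))) \<in> O(\<lambda>n. inverse (real_of_int (r n)))"
    by (rule dirichlet_unimodular_sequence[OF real_conjugate_irrational[OF \<alpha> k(1) \<theta>],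
          folded \<theta>]) (rule that)
  have "(\<lambda>n. inverse (real_of_int (r n))) \<longlonglongrightarrow> 0"
    using lim by (rule tendsto_inverse_0_at_top)
  then have bounded: "(\<lambda>n. inverse (real_of_int (r n))) \<in> O(\<lambda>_. 1)"
    by (intro landau_o.small_imp_big smalloI_tendsto) simp_all
  show thesis
  proof (rule that[OF det lim small])
    fix i assume i: "i \<in> I - {k}"
    then have "emb i \<alpha> \<noteq> emb k \<alpha>"
      using \<alpha>(1) k(1) by (auto simp: generator_iff dest: inj_onD)
    then show "(\<lambda>n. cmod (linear_form (r n) (s n) (emb i \<alpha>))) \<in> \<Theta>(\<lambda>n. real_of_int (r n))"
      using lim landau_o.big_trans[OF small(1) bounded] by (intro linear_form_bigtheta)
    show "(\<lambda>n. cmod (linear_form (p n) (q n) (emb i \<alpha>))) \<in> O(\<lambda>n. real_of_int (r n))"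
      using p landau_o.big_trans[OF small(2) landau_o.big_trans[OF bounded one_bigo_at_top[OF lim]]]
      by (rule linear_form_bigo)
  qed
qed

lemma root_separation_exponent_ge_off_real:
  assumes k: "k \<in> I" "real_embedding (emb k)" and S: "S \<subseteq> I - {k}" "2 \<le> card S"
  shows "ereal (real (card S * (card S - 1)) / real (card I - 2)) \<le> root_separation_exponent emb S"
proof -
  have "card S \<le> card (I - {k})"
    using S(1) by (intro card_mono) auto
  then have I: "3 \<le> card I" "2 \<le> card I"
    using S(2) k(1) by auto
  obtain \<alpha> :: 'k where \<alpha>: "generator \<alpha>"
    using generator_exists by blast
  obtain p q r s t where det: "\<And>n. p n * s n - q n * r n = (1 :: int)"
    and lim: "filterlim t at_top sequentially"
    and small: "(\<lambda>n. cmod (linear_form (r n) (s n) (emb k \<alpha>))) \<in> O(\<lambda>n. inverse (t n))"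
      "(\<lambda>n. cmod (linear_form (p n) (q n) (emb k \<alpha>))) \<in> O(\<lambda>n. inverse (t n))"
    and denominator: "\<And>i. i \<in> I - {k} \<Longrightarrow> (\<lambda>n. cmod (linear_form (r n) (s n) (emb i \<alpha>))) \<in> \<Theta>(t)"
    and numerator: "\<And>i. i \<in> I - {k} \<Longrightarrow> (\<lambda>n. cmod (linear_form (p n) (q n) (emb i \<alpha>))) \<in> O(t)"
    by (rule real_conjugate_sequenceE[OF \<alpha> I(2) k]) (rule that)
  define g where "g i = (if i = k then (\<lambda>n. inverse (t n)) else t)" for i
  have "eventually (\<lambda>n. (\<Prod>i\<in>I. g i n) = t n ^ (card I - 2)) sequentially"
  proof -
    have "(\<Prod>i\<in>I. g i n) = inverse (t n) * t n ^ (card I - 1)" for n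
      using k(1) by (simp add: prod.remove[of I k] g_def)
    moreover have "card I - 1 = Suc (card I - 2)"
      using I(1) by simp
    moreover have "eventually (\<lambda>n. 0 < t n) sequentially"
      using lim by (simp add: filterlim_at_top_dense)
    ultimately show ?thesis
      by (auto elim: eventually_mono)
  qed
  moreover have "(\<lambda>n. alg_mahler_measure (moebius (p n) (q n) (r n) (s n) \<alpha>)) \<in> O(\<lambda>n. \<Prod>i\<in>I. g i n)"
    using small denominator numerator
    by (intro mahler_measure_moebius_bigo[OF \<alpha> I(2) det]) (auto simp: g_def)
  ultimately have "(\<lambda>n. alg_mahler_measure (moebius (p n) (q n) (r n) (s n) \<alpha>)) \<in>
      O(\<lambda>n. t n ^ (card I - 2))"
    by (simp add: landau_o.big.cong)
  moreover have "(\<lambda>n. separation S (moebius (p n) (q n) (r n) (s n) \<alpha>))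
      \<in> O(\<lambda>n. inverse (t n) ^ (card S * (card S - 1)))"
    using S(1) denominator
    by (intro separation_moebius_bigo[OF \<alpha> I(2) det _ lim]) (auto simp: bigtheta_sym)
  ultimately show ?thesis
    using lim I(1) S(2)
    by (intro root_separation_exponent_ge[OF generator_moebius[OF \<alpha> I(2) det]]) auto
qed

end

section \<open>Cubic fields\<close>

definition cubic_discriminant :: "'a \<Rightarrow> 'a \<Rightarrow> 'a \<Rightarrow> 'a \<Rightarrow> 'a::comm_ring_1" where
  "cubic_discriminant a b c d =
     b\<^sup>2 * c\<^sup>2 - 4 * a * c ^ 3 - 4 * b ^ 3 * d - 27 * a\<^sup>2 * d\<^sup>2 + 18 * a * b * c * d"

lemma of_int_cubic_discriminant:
  "of_int (cubic_discriminant a b c d) =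
    cubic_discriminant (of_int a) (of_int b) (of_int c) (of_int d)"
  by (simp add: cubic_discriminant_def)

lemma cubic_discriminant_eq_prod:
  fixes a x y z :: "'a::idom"
  shows "cubic_discriminant
      a (- a * (x + y + z)) (a * (x * y + x * z + y * z)) (- a * (x * y * z)) =
    (a\<^sup>2 * ((x - y) * (x - z) * (y - z)))\<^sup>2"
  by (simp add: cubic_discriminant_def power2_eq_square power3_eq_cube algebra_simps)

lemma cubic_discriminant_ge_1:
  fixes x y z :: complex and a :: int
  assumes P: "of_int_poly P = smult (of_int a) ([:- x, 1:] * [:- y, 1:] * [:- z, 1:])"
    and "a \<noteq> 0" "x \<noteq> y" "x \<noteq> z" "y \<noteq> z"
  shows "1 \<le> (real_of_int a)\<^sup>2 * (cmod (x - y) * cmod (x - z) * cmod (y - z))"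
proof -
  define c where "c m = coeff P m" for m
  have "of_int (c m) = of_int a * coeff ([:- x, 1:] * [:- y, 1:] * [:- z, 1:]) m" for m
    using arg_cong[OF P, of "\<lambda>p. coeff p m"]
    by (simp only: c_def coeff_smult of_int_hom.coeff_map_poly_hom)
  then have c: "of_int (c 3) = (of_int a :: complex)" "of_int (c 2) = - of_int a * (x + y + z)"
    "of_int (c 1) = of_int a * (x * y + x * z + y * z)" "of_int (c 0) = - of_int a * (x * y * z)"
    by (simp_all add: eval_nat_numeral algebra_simps)
  define \<Delta> where "\<Delta> = cubic_discriminant (c 3) (c 2) (c 1) (c 0)"
  have \<Delta>: "of_int \<Delta> = ((of_int a)\<^sup>2 * ((x - y) * (x - z) * (y - z)))\<^sup>2"
    unfolding \<Delta>_def of_int_cubic_discriminant c by (rule cubic_discriminant_eq_prod)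
  also have "\<dots> \<noteq> 0"
    using assms(2-5) by simp
  finally have "1 \<le> \<bar>real_of_int \<Delta>\<bar>"
    by (simp flip: of_int_abs)
  also have "\<dots> = cmod (of_int \<Delta>)"
    by simp
  also have "\<dots> = ((real_of_int a)\<^sup>2 * (cmod (x - y) * cmod (x - z) * cmod (y - z)))\<^sup>2"
    unfolding \<Delta> by (simp add: norm_mult norm_power)
  finally have "1\<^sup>2 \<le> ((real_of_int a)\<^sup>2 * (cmod (x - y) * cmod (x - z) * cmod (y - z)))\<^sup>2"
    by simp
  then show ?thesis
    by (rule power2_le_imp_le) simp
qed

lemma norm_diff_cnj_prod_le:
  assumes "x \<in> \<real>"
  shows "cmod (x - w) * cmod (x - cnj w) * cmod (w - cnj w) \<le> 2 * cmod (x - w) ^ 3"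
proof -
  have "x - cnj w = cnj (x - w)"
    using assms by (simp add: Reals_cnj_iff)
  then have conj: "cmod (x - cnj w) = cmod (x - w)"
    by (simp only: complex_mod_cnj)
  then have "cmod (w - cnj w) \<le> 2 * cmod (x - w)"
    using norm_triangle_ineq4[of "x - cnj w" "x - w"] by simp
  then have "cmod (x - w) * cmod (x - w) * cmod (w - cnj w)
      \<le> cmod (x - w) * cmod (x - w) * (2 * cmod (x - w))"
    by (intro mult_left_mono) auto
  then show ?thesis
    by (simp add: conj power3_eq_cube)
qed

lemma (in number_field) cnj_embE:
  assumes "i \<in> I"
  obtains j where "j \<in> I" "\<And>x. emb j x = cnj (emb i x)"
  using field_embeddingE[OF field_embedding_cnj[OF field_embedding_emb[OF assms]]] by metis

locale cubic_field = number_field emb I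
  for emb :: "nat \<Rightarrow> 'k::field_char_0 \<Rightarrow> complex" and I +
  assumes card_I_eq_3: "card I = 3"
begin

lemma index_set_eqI:
  assumes "{i, j, k} \<subseteq> I" "i \<noteq> j" "i \<noteq> k" "j \<noteq> k"
  shows "I = {i, j, k}"
  by (rule card_subset_eq[symmetric]) (use assms card_I_eq_3 in auto)

lemma separation_triple:
  assumes "i \<noteq> j" "i \<noteq> k" "j \<noteq> k"
  shows "separation {i, j, k} \<alpha> =
    cmod (emb i \<alpha> - emb j \<alpha>) * cmod (emb i \<alpha> - emb k \<alpha>) * cmod (emb j \<alpha> - emb k \<alpha>)"
  using assms by (simp add: separation_insert norm_minus_commute mult_ac)

lemma discriminant_ge_1:
  assumes "generator \<alpha>"
  shows "1 \<le> real_of_int (alg_leading_coeff \<alpha>) ^ (card I - 1) * separation I \<alpha>"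
proof -
  obtain i j k where I: "I = {i, j, k}" "i \<noteq> j" "i \<noteq> k" "j \<noteq> k"
    using card_I_eq_3 by (auto simp: card_3_iff)
  obtain P where P: "0 < alg_leading_coeff \<alpha>"
    "of_int_poly P = smult (of_int (alg_leading_coeff \<alpha>)) (conj_poly \<alpha>)"
    using alg_leading_coeff_primitive[OF assms] by metis
  have "emb i \<alpha> \<noteq> emb j \<alpha>" "emb i \<alpha> \<noteq> emb k \<alpha>" "emb j \<alpha> \<noteq> emb k \<alpha>"
    using assms I by (auto simp: generator_iff)
  moreover have "conj_poly \<alpha> = [:- emb i \<alpha>, 1:] * [:- emb j \<alpha>, 1:] * [:- emb k \<alpha>, 1:]"
    unfolding conj_poly_def unfolding I(1) using I(2-4)
    by (simp add: mult.assoc del: mult_pCons_left mult_pCons_right)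
  ultimately have "1 \<le> (real_of_int (alg_leading_coeff \<alpha>))\<^sup>2 *
      (cmod (emb i \<alpha> - emb j \<alpha>) * cmod (emb i \<alpha> - emb k \<alpha>) * cmod (emb j \<alpha> - emb k \<alpha>))"
    using P by (intro cubic_discriminant_ge_1) simp_all
  then show ?thesis
    using I by (simp add: separation_triple power2_eq_square)
qed

lemma root_separation_exponent_le_2:
  assumes "S \<subseteq> I"
  shows "root_separation_exponent emb S \<le> ereal 2"
proof (rule root_separation_exponent_le)
  show "inverse (2 ^ card (increasing_pairs I)) * alg_mahler_measure \<alpha> powr (- 2) \<le> separation S \<alpha>"
    if "generator \<alpha>" for \<alpha>
    using separation_lower_bound[OF that assms discriminant_ge_1[OF that]]
    by (simp add: card_I_eq_3)
qed simp

lemma separation_le_real_complex_cube: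
  assumes ij: "i \<in> I" "j \<in> I"
    and real: "real_embedding (emb i)" and complex: "complex_embedding (emb j)"
  shows "separation I \<alpha> \<le> 2 * separation {i, j} \<alpha> ^ 3"
proof -
  obtain k where k: "k \<in> I" "\<And>x. emb k x = cnj (emb j x)"
    using cnj_embE[OF ij(2)] by blast
  obtain y where y: "emb j y \<notin> \<real>"
    using complex by (auto simp: complex_embedding_def)
  have real_i: "emb i x \<in> \<real>" for x
    using real by (auto simp: real_embedding_def)
  have ne: "i \<noteq> j" "i \<noteq> k" "j \<noteq> k"
    using real_i[of y] y k(2)[of y] by (auto simp: Reals_cnj_iff)
  then have "I = {i, j, k}"
    using ij k(1) by (intro index_set_eqI) auto
  then have "separation I \<alpha> =
      cmod (emb i \<alpha> - emb j \<alpha>) * cmod (emb i \<alpha> - emb k \<alpha>) * cmod (emb j \<alpha> - emb k \<alpha>)"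
    using separation_triple[OF ne] by simp
  also have "\<dots> \<le> 2 * cmod (emb i \<alpha> - emb j \<alpha>) ^ 3"
    unfolding k(2) by (rule norm_diff_cnj_prod_le[OF real_i])
  also have "cmod (emb i \<alpha> - emb j \<alpha>) = separation {i, j} \<alpha>"
    using ne(1) by (simp add: separation_insert norm_minus_commute)
  finally show ?thesis .
qed

lemma root_separation_exponent_real_complex_le:
  assumes "i \<in> I" "j \<in> I" "real_embedding (emb i)" "complex_embedding (emb j)"
  shows "root_separation_exponent emb {i, j} \<le> ereal (2 / 3)"
proof (rule root_separation_exponent_le)
  define C where "C = inverse (2 ^ card (increasing_pairs I) :: real) / 2"
  show "0 < C powr (1 / 3)"
    by (simp add: C_def)
  fix \<alpha> :: 'k
  assume \<alpha>: "generator \<alpha>"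
  have "2 * C * alg_mahler_measure \<alpha> powr (- 2) \<le> separation I \<alpha>"
    using separation_lower_bound[OF \<alpha> order_refl discriminant_ge_1[OF \<alpha>]]
    by (simp add: C_def card_I_eq_3)
  also have "\<dots> \<le> 2 * separation {i, j} \<alpha> ^ 3"
    by (rule separation_le_real_complex_cube[OF assms])
  finally have "(C * alg_mahler_measure \<alpha> powr (- 2)) powr (1 / 3)
      \<le> (separation {i, j} \<alpha> ^ 3) powr (1 / 3)"
    by (intro powr_mono2) (auto simp: C_def)
  moreover have "(separation {i, j} \<alpha> ^ 3) powr (1 / 3) = separation {i, j} \<alpha>"
    using root_powr_inverse[of 3 "separation {i, j} \<alpha> ^ 3"] separation_nonneg
    by (simp add: real_root_power_cancel)
  moreover have "0 \<le> C"
    by (simp add: C_def)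
  ultimately show "C powr (1 / 3) * alg_mahler_measure \<alpha> powr (- (2 / 3)) \<le> separation {i, j} \<alpha>"
    by (simp add: powr_mult powr_powr)
qed

theorem root_separation_exponent_all: "root_separation_exponent emb I = ereal 2"
  using root_separation_exponent_le_2[OF order_refl] root_separation_exponent_ge_card[OF order_refl]
  by (intro antisym) (simp_all add: card_I_eq_3)

theorem root_separation_exponent_off_real:
  assumes "k \<in> I" "real_embedding (emb k)"
  shows "root_separation_exponent emb (I - {k}) = ereal 2"
proof (rule antisym)
  show "root_separation_exponent emb (I - {k}) \<le> ereal 2"
    by (rule root_separation_exponent_le_2) auto
  show "ereal 2 \<le> root_separation_exponent emb (I - {k})"
    using root_separation_exponent_ge_off_real[OF assms order_refl] assms(1)
    by (simp add: card_I_eq_3)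
qed

theorem root_separation_exponent_real_complex:
  assumes "i \<in> I" "j \<in> I" "real_embedding (emb i)" "complex_embedding (emb j)"
  shows "root_separation_exponent emb {i, j} = ereal (2 / 3)"
proof (rule antisym)
  have "i \<noteq> j"
    using assms(3,4) by (auto simp: real_embedding_def complex_embedding_def)
  then show "ereal (2 / 3) \<le> root_separation_exponent emb {i, j}"
    using root_separation_exponent_ge_card[of "{i, j}"] assms(1,2) by (simp add: card_I_eq_3)
qed (rule root_separation_exponent_real_complex_le[OF assms])

lemma pair_eq_complement:
  assumes "S \<subseteq> I" "card S = 2"
  obtains k where "k \<in> I" "S = I - {k}"
proof -
  have "card (I - S) = 1"
    using assms card_I_eq_3 by (simp add: card_Diff_subset finite_subset)
  then obtain k where "I - S = {k}"
    by (rule card_1_singletonE)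
  with assms(1) that show thesis
    by blast
qed

lemma real_embedding_off_conjugate_pair:
  assumes "conjugate_embeddings (emb i) (emb j)" "I - {k} = {i, j}" "k \<in> I"
  shows "real_embedding (emb k)"
proof -
  have ij: "i \<in> I" "j \<in> I" "i \<noteq> k" "j \<noteq> k"
    using assms(2) by auto
  obtain l where l: "l \<in> I" "\<And>x. emb l x = cnj (emb k x)"
    using cnj_embE[OF assms(3)] by blast
  have "l \<noteq> i" "l \<noteq> j"
    using assms(1) ij emb_eq_iff[of j k] emb_eq_iff[of i k] assms(3) l(2)
    by (force simp: conjugate_embeddings_def fun_eq_iff)+
  with assms(2) l(1) have "l = k"
    by blast
  with l(2) show ?thesis
    using field_embedding_emb[OF assms(3)] by (auto simp: real_embedding_def Reals_cnj_iff)
qed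

theorem root_separation_exponent_pair:
  assumes "S \<subseteq> I" "card S = 2"
    and embeddings: "totally_real TYPE('k) \<or>
      (\<exists>i j. S = {i, j} \<and> conjugate_embeddings (emb i) (emb j))"
  shows "root_separation_exponent emb S = ereal 2"
proof -
  obtain k where k: "k \<in> I" "S = I - {k}"
    by (rule pair_eq_complement[OF assms(1,2)])
  have "real_embedding (emb k)"
    using embeddings real_embedding_off_conjugate_pair[OF _ _ k(1)] field_embedding_emb[OF k(1)]
    unfolding totally_real_def k(2) by blast
  then show ?thesis
    unfolding k(2) by (rule root_separation_exponent_off_real[OF k(1)])
qed

end

theorem theorem1p1:
  fixes emb :: "nat \<Rightarrow> 'k::field_char_0 \<Rightarrow> complex"
    and \<Sigma> :: "nat set"
  assumes "number_field_degree TYPE('k) = 3"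
    and "bij_betw emb {1, 2, 3} {\<sigma>. field_embedding \<sigma>}"
    and "\<Sigma> \<subseteq> {1, 2, 3}"
    and "card \<Sigma> \<ge> 2"
  shows "(\<Sigma> = {1, 2, 3} \<or>
          (totally_real TYPE('k) \<and> card \<Sigma> = 2) \<or>
          (\<exists>i j. \<Sigma> = {i, j} \<and> conjugate_embeddings (emb i) (emb j))
            \<longrightarrow> root_separation_exponent emb \<Sigma> = ereal 2) \<and>
         ((\<exists>i j. \<Sigma> = {i, j} \<and> real_embedding (emb i) \<and> complex_embedding (emb j))
            \<longrightarrow> root_separation_exponent emb \<Sigma> = ereal (2 / 3))"
proof -
  interpret cubic_field emb "{1, 2, 3}"
    using assms(1,2) by unfold_locales simp_all
  have card_pair: "card \<Sigma> = 2" if "\<Sigma> = {i, j}" for i j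
    using assms(4) card_insert_le_m1[of 2 "{j}" i] by (simp add: that)
  show ?thesis
  proof (intro conjI impI)
    assume "\<Sigma> = {1, 2, 3} \<or> (totally_real TYPE('k) \<and> card \<Sigma> = 2) \<or>
      (\<exists>i j. \<Sigma> = {i, j} \<and> conjugate_embeddings (emb i) (emb j))"
    then show "root_separation_exponent emb \<Sigma> = ereal 2"
      using root_separation_exponent_all root_separation_exponent_pair[OF assms(3)] card_pair
      by blast
  next
    assume "\<exists>i j. \<Sigma> = {i, j} \<and> real_embedding (emb i) \<and> complex_embedding (emb j)"
    then show "root_separation_exponent emb \<Sigma> = ereal (2 / 3)"
      using root_separation_exponent_real_complex assms(3) by blast
  qed
qed

end
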